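(* Let $d\ge 2$ and $2\le n_1\le n_2\le\cdots\le n_d$ be integers, let $\boldsymbol{\mathcal{F}}\in\mathbb{H}^{n_1\times\cdots\times n_d}$ be a commutative quaternion tensor with multilinear form $\boldsymbol{F}$, and consider $$(F)\quad \max\ \operatorname{Re}\boldsymbol{F}(\boldsymbol{x}^1,\dots,\boldsymbol{x}^d)\quad\text{s.t. } \boldsymbol{x}^k\in\mathbf{S}^{n_k},\ k=1,\dots,d,$$ with optimal value $v^*(F)$. Then the randomized Algorithm A described in the context solves $(F)$ with approximation ratio $\gamma^{\frac{d-2}{2}}\prod_{k=1}^{d-2}\sqrt{\frac{\ln n_k}{n_k}}$; that is, for any given $\epsilon>0$ and $\gamma\in\left(0,\frac{n_1}{\ln n_1}\right)$, it generates in polynomial time, with probability at least $1-\epsilon$, a feasible solution $(\boldsymbol{y}^1,\dots,\boldsymbol{y}^d)$ of $(F)$ such that $$\operatorname{Re}\boldsymbol{F}(\boldsymbol{y}^1,\dots,\boldsymbol{y}^d)\ \ge\ \gamma^{\frac{d-2}{2}}\left(\prod_{k=1}^{d-2}\sqrt{\frac{\ln n_k}{n_k}}\right)v^*(F).$$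
   Context: The commutative quaternions are $\mathbb{H}=\{q_0+q_1\boldsymbol{i}+q_2\boldsymbol{j}+q_3\boldsymbol{k}: q_0,q_1,q_2,q_3\in\mathbb{R}\}$ with the commutative multiplication determined by $\boldsymbol{i}^2=\boldsymbol{k}^2=-1$, $\boldsymbol{j}^2=1$, $\boldsymbol{i}\boldsymbol{j}=\boldsymbol{j}\boldsymbol{i}=\boldsymbol{k}$, $\boldsymbol{j}\boldsymbol{k}=\boldsymbol{k}\boldsymbol{j}=\boldsymbol{i}$, $\boldsymbol{k}\boldsymbol{i}=\boldsymbol{i}\boldsymbol{k}=-\boldsymbol{j}$, and $\operatorname{Re}(q_0+q_1\boldsymbol{i}+q_2\boldsymbol{j}+q_3\boldsymbol{k})=q_0$. For $\boldsymbol{x}=x_0+x_1\boldsymbol{i}+x_2\boldsymbol{j}+x_3\boldsymbol{k}\in\mathbb{H}^n$ ($x_i\in\mathbb{R}^n$), $\|\boldsymbol{x}\|=\left(\sum_{i=0}^3 x_i^\top x_i\right)^{1/2}$, and $\mathbf{S}^n=\{\boldsymbol{x}\in\mathbb{H}^n:\|\boldsymbol{x}\|=1\}$. A random $\boldsymbol{\xi}\in\mathbb{H}^n$ is uniform on $\mathbf{S}^n$ if $(\xi_0^\top,\xi_1^\top,\xi_2^\top,\xi_3^\top)^\top$ is uniform on the Euclidean unit sphere of $\mathbb{R}^{4n}$. The multilinear form of $\boldsymbol{\mathcal{F}}\in\mathbb{H}^{n_1\times\cdots\times n_d}$ is $\boldsymbol{F}(\boldsymbol{x}^1,\dots,\boldsymbol{x}^d)=\sum_{i_1=1}^{n_1}\cdots\sum_{i_d=1}^{n_d}\boldsymbol{\mathcal{F}}_{i_1\cdots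 i_d}\boldsymbol{x}^1_{i_1}\cdots\boldsymbol{x}^d_{i_d}$. Constant $c(\gamma)$: for given $\gamma>0$, $c(\gamma)>0$ is a constant depending only on $\gamma$ such that for every integer $n\ge2$ with $\gamma\ln n<n$, every $\boldsymbol{a}\in\mathbb{H}^n$ and $\boldsymbol{\xi}$ uniform on $\mathbf{S}^n$, $\operatorname{Prob}\{\operatorname{Re}(\boldsymbol{a}^\top\boldsymbol{\xi})\ge\sqrt{\gamma\ln n/n}\,\|\boldsymbol{a}\|\}\ge c(\gamma)/(n^{4.5\gamma}\sqrt{\ln n})$. Algorithm A (input $\boldsymbol{\mathcal{F}}$, $\epsilon$, $\gamma$): (1) independently generate $\boldsymbol{\xi}^k$ uniformly on $\mathbf{S}^{n_k}$ for $k=1,\dots,d-2$. (2) Solve $\max\operatorname{Re}\boldsymbol{F}(\boldsymbol{\xi}^1,\dots,\boldsymbol{\xi}^{d-2},\boldsymbol{x}^{d-1},\boldsymbol{x}^d)$ over $\boldsymbol{x}^{d-1}\in\mathbf{S}^{n_{d-1}}$, $\boldsymbol{x}^d\in\mathbf{S}^{n_d}$, obtaining $(\boldsymbol{\xi}^{d-1},\boldsymbol{\xi}^d)$. (3) Compute $\operatorname{Re}\boldsymbol{F}(\boldsymbol{\xi}^1,\dots,\boldsymbol{\xi}^d)$. (4) Repeat steps (1)–(3) independently $\ln\frac1\epsilon\cdot\frac{1}{c(\gamma)^{d-2}}\prod_{k=1}^{d-2}n_k^{4.5\gamma}\sqrt{\ln n_k}$ times (rounded up to an integer, and at least once), and output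 a solution with the largest objective value. Conventions: $d$, $\gamma$ and $\epsilon$ are given (fixed), and polynomial time means polynomial in $n_1,\dots,n_d$. The problem in step (2) is a bilinear problem over unit spheres; as a problem of computing the spectral norm (with a leading singular pair) of a real matrix, it is regarded as exactly solvable in polynomial time.
   Formalization: The formal theorem requires γ < n_k/ln n_k for every k ≤ d−2, not only k=1; this excludes only n_1=2, some n_k=3, 3/ln 3 ≤ γ < 2/ln 2, where the claim can fail: for d=4, n=(2,3,3,3), γ=2.85 the ratio exceeds 1. *)

theory Defs
  imports "HOL-Probability.Probability" "HOL-Library.Monad_Syntax"
begin

section \<open>Commutative quaternions\<close>

datatype cquat = CQ (cqRe: real) (cqI: real) (cqJ: real) (cqK: real)

lemma cquat_eq_iff:
  "x = y \<longleftrightarrow> cqRe x = cqRe y \<and> cqI x = cqI y \<and> cqJ x = cqJ y \<and> cqK x = cqK y"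
  by (cases x; cases y) simp

instantiation cquat :: comm_ring_1
begin

definition "0 = CQ 0 0 0 0"
definition "1 = CQ 1 0 0 0"
definition "x + y = CQ (cqRe x + cqRe y) (cqI x + cqI y) (cqJ x + cqJ y) (cqK x + cqK y)"
definition "x - y = CQ (cqRe x - cqRe y) (cqI x - cqI y) (cqJ x - cqJ y) (cqK x - cqK y)"
definition "- x = CQ (- cqRe x) (- cqI x) (- cqJ x) (- cqK x)"
definition "x * y = CQ
   (cqRe x * cqRe y - cqI x * cqI y + cqJ x * cqJ y - cqK x * cqK y)
   (cqRe x * cqI y + cqI x * cqRe y + cqJ x * cqK y + cqK x * cqJ y)
   (cqRe x * cqJ y + cqJ x * cqRe y - cqI x * cqK y - cqK x * cqI y)
   (cqRe x * cqK y + cqK x * cqRe y + cqI x * cqJ y + cqJ x * cqI y)"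

instance
  by standard
    (auto simp: zero_cquat_def one_cquat_def plus_cquat_def minus_cquat_def uminus_cquat_def
        times_cquat_def cquat_eq_iff algebra_simps)

end

lemma cquat_mult_table:
  defines "qi \<equiv> CQ 0 1 0 0" and "qj \<equiv> CQ 0 0 1 0" and "qk \<equiv> CQ 0 0 0 1"
  shows "qi * qi = -1" "qk * qk = -1" "qj * qj = 1" "qi * qj = qk" "qj * qk = qi" "qk * qi = - qj"
  by (simp_all add: assms one_cquat_def times_cquat_def uminus_cquat_def)

lemma cquat_sel_simps [simp]:
  "cqRe 0 = 0" "cqI 0 = 0" "cqJ 0 = 0" "cqK 0 = 0"
  "cqRe 1 = 1" "cqI 1 = 0" "cqJ 1 = 0" "cqK 1 = 0"
  "cqRe (x + y) = cqRe x + cqRe y" "cqI (x + y) = cqI x + cqI y"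
  "cqJ (x + y) = cqJ x + cqJ y" "cqK (x + y) = cqK x + cqK y"
  "cqRe (x - y) = cqRe x - cqRe y" "cqI (x - y) = cqI x - cqI y"
  "cqJ (x - y) = cqJ x - cqJ y" "cqK (x - y) = cqK x - cqK y"
  "cqRe (- x) = - cqRe x" "cqI (- x) = - cqI x" "cqJ (- x) = - cqJ x" "cqK (- x) = - cqK x"
  by (simp_all add: zero_cquat_def one_cquat_def plus_cquat_def minus_cquat_def uminus_cquat_def)

text \<open>The Euclidean structure of $\mathbb{R}^4$, which also provides the Borel sigma-algebra.\<close>

instantiation cquat :: real_vector
begin

definition "scaleR r x = CQ (r * cqRe x) (r * cqI x) (r * cqJ x) (r * cqK x)"

instance
  by standard (auto simp: scaleR_cquat_def cquat_eq_iff algebra_simps)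

end

instantiation cquat :: real_inner
begin

definition inner_cquat_def:
  "inner x y = cqRe x * cqRe y + cqI x * cqI y + cqJ x * cqJ y + cqK x * cqK y"
definition norm_cquat_def: "norm (x :: cquat) = sqrt (inner x x)"
definition sgn_cquat_def: "sgn (x :: cquat) = x /\<^sub>R norm x"
definition dist_cquat_def: "dist x y = norm (x - y :: cquat)"
definition uniformity_cquat_def [code del]:
  "(uniformity :: (cquat \<times> cquat) filter) = (INF e\<in>{0 <..}. principal {(x, y). dist x y < e})"
definition open_cquat_def [code del]:
  "open (U :: cquat set) \<longleftrightarrow> (\<forall>x\<in>U. eventually (\<lambda>(x', y). x' = x \<longrightarrow> y \<in> U) uniformity)"

instance
proof
  fix x y z :: cquat and r :: real and U :: "cquat set"
  show "dist x y = norm (x - y)" by (rule dist_cquat_def)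
  show "sgn x = x /\<^sub>R norm x" by (rule sgn_cquat_def)
  show "(uniformity :: (cquat \<times> cquat) filter) = (INF e\<in>{0 <..}. principal {(x, y). dist x y < e})"
    by (rule uniformity_cquat_def)
  show "open U \<longleftrightarrow> (\<forall>x\<in>U. eventually (\<lambda>(x', y). x' = x \<longrightarrow> y \<in> U) uniformity)"
    by (rule open_cquat_def)
  show "inner x y = inner y x" by (simp add: inner_cquat_def mult.commute)
  show "inner (x + y) z = inner x z + inner y z" by (simp add: inner_cquat_def algebra_simps)
  show "inner (r *\<^sub>R x) y = r * inner x y"
    by (simp add: inner_cquat_def scaleR_cquat_def algebra_simps)
  show "0 \<le> inner x x" by (simp add: inner_cquat_def)
  show "inner x x = 0 \<longleftrightarrow> x = 0"
    by (auto simp: inner_cquat_def cquat_eq_iff add_nonneg_eq_0_iff)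
  show "norm x = sqrt (inner x x)" by (rule norm_cquat_def)
qed

end

instantiation cquat :: euclidean_space
begin

definition Basis_cquat_def: "Basis = {CQ 1 0 0 0, CQ 0 1 0 0, CQ 0 0 1 0, CQ 0 0 0 1}"

instance
proof
  show "(Basis :: cquat set) \<noteq> {}" "finite (Basis :: cquat set)"
    by (simp_all add: Basis_cquat_def)
  fix x u v :: cquat
  show "u \<in> Basis \<Longrightarrow> v \<in> Basis \<Longrightarrow> inner u v = (if u = v then 1 else 0)"
    unfolding Basis_cquat_def by (elim insertE emptyE) (simp_all add: inner_cquat_def)
  show "(\<forall>u\<in>Basis. inner x u = 0) \<longleftrightarrow> x = 0"
    by (simp add: Basis_cquat_def inner_cquat_def cquat_eq_iff[of x 0])
qed

end


section \<open>Vectors, the sphere and its uniform distribution\<close>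

text \<open>$\mathbb{H}^n$ is the set of functions on $\{0,\dots,n-1\}$, extended by
  \<^term>\<open>undefined\<close>; this is the carrier of the product sigma-algebra below.\<close>

type_synonym cvec = "nat \<Rightarrow> cquat"

definition cspace :: "nat \<Rightarrow> cvec set" where
  "cspace n = {..<n} \<rightarrow>\<^sub>E UNIV"

definition cnorm :: "nat \<Rightarrow> cvec \<Rightarrow> real" where
  "cnorm n x = sqrt ((\<Sum>i<n. (cqRe (x i))\<^sup>2) + (\<Sum>i<n. (cqI (x i))\<^sup>2)
                   + (\<Sum>i<n. (cqJ (x i))\<^sup>2) + (\<Sum>i<n. (cqK (x i))\<^sup>2))"

definition csphere :: "nat \<Rightarrow> cvec set" where
  "csphere n = {x \<in> cspace n. cnorm n x = 1}"

text \<open>The uniform distribution on the Euclidean unit sphere of $\mathbb{R}^I$ ($I$ finite and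
  nonempty) is the normalised cone measure: the image under radial projection of the uniform
  distribution on the unit ball.\<close>

definition unit_sphere_measure :: "'i set \<Rightarrow> ('i \<Rightarrow> real) measure" where
  "unit_sphere_measure I =
     distr (uniform_measure (Pi\<^sub>M I (\<lambda>_. lborel)) {x \<in> space (Pi\<^sub>M I (\<lambda>_. lborel)). L2_set x I \<le> 1})
           (Pi\<^sub>M I (\<lambda>_. borel))
           (\<lambda>x. \<lambda>i\<in>I. x i / L2_set x I)"

text \<open>The coordinate $(c,i)$ of $\mathbb{R}^{4n}$ is the $i$-th entry of the $c$-th real
  component vector.\<close>

definition unstack :: "nat \<Rightarrow> (nat \<times> nat \<Rightarrow> real) \<Rightarrow> cvec" where
  "unstack n u = (\<lambda>i\<in>{..<n}. CQ (u (0, i)) (u (1, i)) (u (2, i)) (u (3, i)))"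

definition uniform_csphere :: "nat \<Rightarrow> cvec measure" where
  "uniform_csphere n =
     distr (unit_sphere_measure ({..<4} \<times> {..<n})) (Pi\<^sub>M {..<n} (\<lambda>_. borel)) (unstack n)"

text \<open>The property required of the constant $c(\gamma)$.\<close>

definition tail_constant :: "real \<Rightarrow> real \<Rightarrow> bool" where
  "tail_constant \<gamma> c \<longleftrightarrow> c > 0 \<and>
     (\<forall>n\<ge>2. \<gamma> * ln (real n) < real n \<longrightarrow> (\<forall>a\<in>cspace n.
        measure (uniform_csphere n)
          {\<xi> \<in> space (uniform_csphere n).
             cqRe (\<Sum>i<n. a i * \<xi> i) \<ge> sqrt (\<gamma> * ln (real n) / real n) * cnorm n a}
        \<ge> c / (real n powr (4.5 * \<gamma>) * sqrt (ln (real n)))))"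


section \<open>Tensors and the optimisation problem\<close>

text \<open>The dimensions are a list \<open>ns\<close> of length $d$. A tensor assigns a value to each multi-index,
  a list of length $d$; all positions and indices count from 0, so $n_k$ is \<open>ns ! (k - 1)\<close>.\<close>

type_synonym ctensor = "nat list \<Rightarrow> cquat"

definition multi_indices :: "nat list \<Rightarrow> nat list set" where
  "multi_indices ns = {is. length is = length ns \<and> (\<forall>k<length ns. is ! k < ns ! k)}"

definition multilinear_form :: "nat list \<Rightarrow> ctensor \<Rightarrow> cvec list \<Rightarrow> cquat" where
  "multilinear_form ns F xs =
     (\<Sum>is\<in>multi_indices ns. F is * (\<Prod>k<length ns. (xs ! k) (is ! k)))"

definition feasible :: "nat list \<Rightarrow> cvec list \<Rightarrow> bool" where
  "feasible ns xs \<longleftrightarrow> length xs = length ns \<and> (\<forall>k<length ns. xs ! k \<in> csphere (ns ! k))"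

definition opt_value :: "nat list \<Rightarrow> ctensor \<Rightarrow> real" where
  "opt_value ns F = (SUP xs\<in>{xs. feasible ns xs}. cqRe (multilinear_form ns F xs))"

definition approx_ratio :: "real \<Rightarrow> nat list \<Rightarrow> real" where
  "approx_ratio \<gamma> ns = \<gamma> powr ((real (length ns) - 2) / 2) *
     (\<Prod>k<length ns - 2. sqrt (ln (real (ns ! k)) / real (ns ! k)))"


section \<open>Computations with a running time\<close>

text \<open>Running time is counted in the real-number (unit cost) model: reading, drawing, adding,
  multiplying or comparing one real number costs one step.\<close>

datatype 'a timed = Timed (result: 'a) (steps: nat)

definition bind_timed :: "'a timed \<Rightarrow> ('a \<Rightarrow> 'b timed) \<Rightarrow> 'b timed" where
  "bind_timed m f = Timed (result (f (result m))) (steps m + steps (f (result m)))"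

adhoc_overloading Monad_Syntax.bind \<rightleftharpoons> bind_timed

definition return :: "'a \<Rightarrow> 'a timed" where
  "return x = Timed x 0"

definition charge :: "nat \<Rightarrow> unit timed" where
  "charge t = Timed () t"

definition cq_read :: "cquat \<Rightarrow> cquat timed" where
  "cq_read a = Timed a 4"

definition cq_add :: "cquat \<Rightarrow> cquat \<Rightarrow> cquat timed" where
  "cq_add a b = Timed (a + b) 4"

text \<open>16 real multiplications and 12 real additions.\<close>

definition cq_mult :: "cquat \<Rightarrow> cquat \<Rightarrow> cquat timed" where
  "cq_mult a b = Timed (a * b) 28"

primrec map_timed :: "('a \<Rightarrow> 'b timed) \<Rightarrow> 'a list \<Rightarrow> 'b list timed" where
  "map_timed f [] = return []"
| "map_timed f (x # xs) = do { y \<leftarrow> f x; ys \<leftarrow> map_timed f xs; return (y # ys) }"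

definition tabulate :: "nat \<Rightarrow> (nat \<Rightarrow> 'a timed) \<Rightarrow> (nat \<Rightarrow> 'a) timed" where
  "tabulate m f = Timed (\<lambda>i\<in>{..<m}. result (f i)) (\<Sum>i<m. steps (f i))"

primrec loop_sum :: "nat \<Rightarrow> (nat \<Rightarrow> cquat timed) \<Rightarrow> cquat timed" where
  "loop_sum 0 f = return 0"
| "loop_sum (Suc m) f = do { s \<leftarrow> loop_sum m f; a \<leftarrow> f m; cq_add s a }"

primrec nested_sum :: "nat list \<Rightarrow> (nat list \<Rightarrow> cquat timed) \<Rightarrow> cquat timed" where
  "nested_sum [] f = f []"
| "nested_sum (m # ms) f = loop_sum m (\<lambda>i. nested_sum ms (\<lambda>is. f (i # is)))"

fun mult_entries :: "cquat \<Rightarrow> cvec list \<Rightarrow> nat list \<Rightarrow> cquat timed" where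
  "mult_entries a (x # xs) (i # is) = do { b \<leftarrow> cq_read (x i); c \<leftarrow> cq_mult a b; mult_entries c xs is }"
| "mult_entries a _ _ = return a"

definition eval_form :: "nat list \<Rightarrow> ctensor \<Rightarrow> cvec list \<Rightarrow> cquat timed" where
  "eval_form ns F xs = nested_sum ns (\<lambda>is. do { a \<leftarrow> cq_read (F is); mult_entries a xs is })"

text \<open>The coefficient matrix of the bilinear form $F(x^1,\dots,x^{d-2},\cdot,\cdot)$.\<close>

definition contract :: "nat list \<Rightarrow> ctensor \<Rightarrow> cvec list \<Rightarrow> (nat \<Rightarrow> nat \<Rightarrow> cquat) timed" where
  "contract ns F xs =
     (let d = length ns in
      tabulate (ns ! (d - 2)) (\<lambda>i. tabulate (ns ! (d - 1)) (\<lambda>j.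
        nested_sum (take (d - 2) ns)
          (\<lambda>is. do { a \<leftarrow> cq_read (F (is @ [i, j])); mult_entries a xs is }))))"


section \<open>The algorithm\<close>

text \<open>An exact polynomial-time solver for
  $\max \mathrm{Re} \sum_{i<p} \sum_{j<q} B_{ij} x_i y_j$ over $x \in \mathbf{S}^p$,
  $y \in \mathbf{S}^q$.\<close>

type_synonym solver = "nat \<Rightarrow> nat \<Rightarrow> (nat \<Rightarrow> nat \<Rightarrow> cquat) \<Rightarrow> (cvec \<times> cvec) timed"

definition bilinear_form :: "nat \<Rightarrow> nat \<Rightarrow> (nat \<Rightarrow> nat \<Rightarrow> cquat) \<Rightarrow> cvec \<Rightarrow> cvec \<Rightarrow> cquat" where
  "bilinear_form p q B x y = (\<Sum>i<p. \<Sum>j<q. B i j * x i * y j)"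

definition exact_poly_solver :: "solver \<Rightarrow> bool" where
  "exact_poly_solver solve \<longleftrightarrow>
     (\<forall>p>0. \<forall>q>0. \<forall>B. case result (solve p q B) of (x, y) \<Rightarrow>
        x \<in> csphere p \<and> y \<in> csphere q \<and>
        (\<forall>u\<in>csphere p. \<forall>v\<in>csphere q.
           cqRe (bilinear_form p q B u v) \<le> cqRe (bilinear_form p q B x y))) \<and>
     (\<exists>C K. \<forall>p>0. \<forall>q>0. \<forall>B. steps (solve p q B) \<le> C * (p + q) ^ K)"

definition repetitions :: "real \<Rightarrow> real \<Rightarrow> real \<Rightarrow> nat list \<Rightarrow> nat" where
  "repetitions \<epsilon> \<gamma> c ns =
     max 1 (nat \<lceil>ln (1 / \<epsilon>) * (1 / c ^ (length ns - 2)) *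
       (\<Prod>k<length ns - 2. real (ns ! k) powr (4.5 * \<gamma>) * sqrt (ln (real (ns ! k))))\<rceil>)"

text \<open>The random source: \<open>\<omega> (r, k)\<close> is the vector on $\mathbf{S}^{n_{k+1}}$ drawn in repetition
  \<open>r\<close>; all draws are independent. The algorithm is deterministic given \<open>\<omega>\<close>.\<close>

type_synonym samples = "nat \<times> nat \<Rightarrow> cvec"

definition sample_space :: "nat list \<Rightarrow> nat \<Rightarrow> samples measure" where
  "sample_space ns N = Pi\<^sub>M ({..<N} \<times> {..<length ns - 2}) (\<lambda>(r, k). uniform_csphere (ns ! k))"

definition draw :: "nat list \<Rightarrow> samples \<Rightarrow> nat \<Rightarrow> nat \<Rightarrow> cvec timed" where
  "draw ns \<omega> r k = Timed (\<omega> (r, k)) (4 * ns ! k)"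

definition trial ::
  "solver \<Rightarrow> nat list \<Rightarrow> ctensor \<Rightarrow> samples \<Rightarrow> nat \<Rightarrow> (cvec list \<times> real) timed" where
  "trial solve ns F \<omega> r = do {
     let d = length ns;
     xs \<leftarrow> map_timed (draw ns \<omega> r) [0..<d - 2];
     B \<leftarrow> contract ns F xs;
     (x, y) \<leftarrow> solve (ns ! (d - 2)) (ns ! (d - 1)) B;
     let ys = xs @ [x, y];
     v \<leftarrow> eval_form ns F ys;
     return (ys, cqRe v)
   }"

text \<open>The best of the trials \<open>0, \<dots>, r\<close>.\<close>

primrec best_trial ::
  "solver \<Rightarrow> nat list \<Rightarrow> ctensor \<Rightarrow> samples \<Rightarrow> nat \<Rightarrow> (cvec list \<times> real) timed" where
  "best_trial solve ns F \<omega> 0 = trial solve ns F \<omega> 0"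
| "best_trial solve ns F \<omega> (Suc r) = do {
     (ys, v) \<leftarrow> best_trial solve ns F \<omega> r;
     (zs, w) \<leftarrow> trial solve ns F \<omega> (Suc r);
     charge 1;
     return (if w > v then (zs, w) else (ys, v))
   }"

text \<open>The charge covers the evaluation of the formula for the number of repetitions: a bounded
  number of elementary operations per dimension.\<close>

definition algorithm_A ::
  "solver \<Rightarrow> real \<Rightarrow> real \<Rightarrow> real \<Rightarrow> nat list \<Rightarrow> ctensor \<Rightarrow> samples \<Rightarrow> cvec list timed" where
  "algorithm_A solve \<epsilon> \<gamma> c ns F \<omega> = do {
     charge (10 * length ns);
     (ys, v) \<leftarrow> best_trial solve ns F \<omega> (repetitions \<epsilon> \<gamma> c ns - 1);
     return ys
   }"


section \<open>Basic facts\<close>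

lemma prob_space_unit_sphere_measure:
  assumes "finite I" "I \<noteq> {}"
  shows "prob_space (unit_sphere_measure I)"
proof -
  let ?P = "Pi\<^sub>M I (\<lambda>_. lborel :: real measure)"
  let ?B = "{x \<in> space ?P. L2_set x I \<le> 1}"
  have "?B = {f. sqrt (\<Sum>i\<in>I. (f i)\<^sup>2) \<le> 1} \<inter> space ?P"
    by (auto simp: L2_set_def)
  then have "emeasure ?P ?B = ennreal (unit_ball_vol (real (card I)))"
    using emeasure_cball_aux[OF assms(1), of 1] by simp
  then have "prob_space (uniform_measure ?P ?B)"
    by (intro prob_space_uniform_measure) (simp_all add: unit_ball_vol_pos ennreal_eq_0_iff not_le)
  moreover have "(\<lambda>x. \<lambda>i\<in>I. x i / L2_set x I) \<in> uniform_measure ?P ?B \<rightarrow>\<^sub>M Pi\<^sub>M I (\<lambda>_. borel)"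
    unfolding L2_set_def by measurable
  ultimately show ?thesis
    unfolding unit_sphere_measure_def by (rule prob_space.prob_space_distr)
qed

text \<open>As $x / \ln x$ takes its minimum over the integers $x \ge 2$ at $3$, the bound
  $\gamma < n_1 / \ln n_1$ passes to the larger dimensions, except from $2$ to $3$. In that
  case ($d \ge 4$, $n_1 = 2$, $n_2 = 3$, $3 / \ln 3 \le \gamma < 2 / \ln 2$) the approximation
  ratio can exceed $1$, so the bound has to be required of every $n_k$ with $k \le d - 2$.\<close>

lemma dimension_condition_mono:
  fixes m n :: nat
  assumes "\<gamma> > 0" "\<gamma> < m / ln m" "2 \<le> m" "m \<le> n" "\<not> (m = 2 \<and> n = 3)"
  shows "\<gamma> < n / ln n"
proof -
  have e: "exp 1 \<le> (3::real)" by (rule exp_le)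
  have le: "ln n / n \<le> ln m / m"
  proof (cases "m = 2")
    case False
    then have "ln (real n) / real n \<le> ln (real m) / real m"
      using assms e by (intro ln_x_over_x_mono) linarith+
    then show ?thesis .
  next
    case True
    show ?thesis
    proof (cases "n = 2")
      case False
      then have "n \<ge> 4" using assms True by linarith
      then have "ln (real n) / real n \<le> ln 4 / 4"
        using e by (intro ln_x_over_x_mono) linarith+
      also have "ln 4 = 2 * ln (2::real)"
        using ln_realpow[of 2 2] by simp
      finally show ?thesis using True by simp
    qed (use True in simp)
  qed
  have "0 < ln (real n)" "0 < ln (real m)" using assms by auto
  with le have "m / ln m \<le> n / ln n"
    using assms by (simp add: field_simps)
  with assms show ?thesis by linarith
qed

end

theory Submission
  imports Defs
begin

text \<open>
  Fix an optimal solution \<open>X\<close>; it exists since the spheres are compact and the objective is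
  continuous. In the analysis of one trial, replace $X_1,\dots,X_{d-2}$ one after the other by the
  random vectors. With all slots but the \<open>k\<close>-th fixed, the objective is \<open>Re (a\<^sup>T x)\<close> for some
  coefficient vector \<open>a\<close>, and by Cauchy-Schwarz its value at the old unit vector is at most
  \<open>\<parallel>a\<parallel>\<close>. The defining property of $c(\gamma)$ therefore says that the random vector keeps at least the
  fraction $\sqrt{\gamma\ln n_k/n_k}$ of the current value with probability at least
  $c(\gamma)/(n_k^{4.5\gamma}\sqrt{\ln n_k})$ (\<open>replace_slot_by_uniform\<close>). By Fubini these probabilities
  multiply (\<open>hybrid_probability\<close>): with probability at least their product \<open>p\<close>, the point with the
  random vectors in the first $d-2$ slots and $X_{d-1}, X_d$ in the last two has at least the
  claimed fraction of the optimal value. The exact solver does at least as well as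
  $X_{d-1}, X_d$, so a trial succeeds with probability at least \<open>p\<close>.

  The trials are independent, and their number \<open>N\<close> is at least $\ln(1/\epsilon)/p$, so all of them fail
  with probability at most $(1-p)^N \le e^{-pN} \le \epsilon$
  (\<open>some_trial_succeeds\<close>, \<open>exp_repetitions_le\<close>).

  The success event has to be measurable although the solver is an arbitrary function. The value of
  a trial is a maximum of continuous functions over two separable spheres, hence a measurable
  function of the samples; which trial is returned, and whether it is feasible, depends only on
  these values and on the samples (\<open>borel_measurable_trial_value\<close>, \<open>pred_best_index\<close>).

  The running time is a matter of counting: for fixed \<open>d\<close> and \<open>\<gamma>\<close> both the cost of a trial and the
  number of repetitions are bounded by a power of the sum of the dimensions
  (\<open>steps_algorithm_A_polynomial\<close>).
\<close>

section \<open>Commutative quaternions as a topological ring\<close>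

text \<open>Each component is the inner product with a basis vector. The norm of \<^typ>\<open>cquat\<close> is not
  submultiplicative, so the quaternions are a topological ring but no normed algebra; continuity
  and measurability of the product come from its components.\<close>

lemma bounded_linear_cquat_components:
  "bounded_linear cqRe" "bounded_linear cqI" "bounded_linear cqJ" "bounded_linear cqK"
  using bounded_linear_inner_left[of "CQ 1 0 0 0"] bounded_linear_inner_left[of "CQ 0 1 0 0"]
    bounded_linear_inner_left[of "CQ 0 0 1 0"] bounded_linear_inner_left[of "CQ 0 0 0 1"]
  by (simp_all add: inner_cquat_def)

lemmas tendsto_cquat_components [tendsto_intros] =
  bounded_linear_cquat_components[THEN bounded_linear.tendsto]

lemmas continuous_on_cquat_components [continuous_intros] =
  bounded_linear_cquat_components[THEN bounded_linear.continuous_on]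

lemma CQ_eq_scaleR_basis:
  "CQ a b c d = a *\<^sub>R CQ 1 0 0 0 + b *\<^sub>R CQ 0 1 0 0 + c *\<^sub>R CQ 0 0 1 0 + d *\<^sub>R CQ 0 0 0 1"
  by (simp add: scaleR_cquat_def cquat_eq_iff)

lemma tendsto_CQ [tendsto_intros]:
  "(a \<longlongrightarrow> a') F \<Longrightarrow> (b \<longlongrightarrow> b') F \<Longrightarrow> (c \<longlongrightarrow> c') F \<Longrightarrow> (d \<longlongrightarrow> d') F \<Longrightarrow>
   ((\<lambda>x. CQ (a x) (b x) (c x) (d x)) \<longlongrightarrow> CQ a' b' c' d') F"
  by (subst (1 2) CQ_eq_scaleR_basis) (intro tendsto_intros)

instance cquat :: topological_comm_monoid_mult
proof
  fix a b :: cquat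
  show "((\<lambda>x. fst x * snd x) \<longlongrightarrow> a * b) (nhds a \<times>\<^sub>F nhds b)"
    unfolding times_cquat_def
    by (intro tendsto_intros filterlim_fst filterlim_snd)
qed

lemma borel_measurable_cquat_components [measurable]:
  "cqRe \<in> borel_measurable borel" "cqI \<in> borel_measurable borel"
  "cqJ \<in> borel_measurable borel" "cqK \<in> borel_measurable borel"
  by (intro borel_measurable_continuous_onI continuous_intros)+

lemma borel_measurable_CQ [measurable (raw)]:
  assumes [measurable]: "a \<in> borel_measurable M" "b \<in> borel_measurable M"
    "c \<in> borel_measurable M" "d \<in> borel_measurable M"
  shows "(\<lambda>x. CQ (a x) (b x) (c x) (d x)) \<in> borel_measurable M"
  by (subst CQ_eq_scaleR_basis) measurable

lemma borel_measurable_cquat_times [measurable (raw)]: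
  fixes f g :: "'a \<Rightarrow> cquat"
  assumes "f \<in> borel_measurable M" "g \<in> borel_measurable M"
  shows "(\<lambda>x. f x * g x) \<in> borel_measurable M"
  using assms by (rule borel_measurable_continuous_Pair) (intro continuous_intros)

lemma borel_measurable_cquat_prod [measurable (raw)]:
  fixes f :: "'c \<Rightarrow> 'a \<Rightarrow> cquat"
  assumes "\<And>i. i \<in> S \<Longrightarrow> f i \<in> borel_measurable M"
  shows "(\<lambda>x. \<Prod>i\<in>S. f i x) \<in> borel_measurable M"
  using assms by (induction S rule: infinite_finite_induct) auto

lemma cqRe_sum: "cqRe (sum f S) = (\<Sum>i\<in>S. cqRe (f i))"
  by (rule linear_sum) (rule bounded_linear.linear[OF bounded_linear_cquat_components(1)])

lemma cnorm_eq_L2_set: "cnorm n x = L2_set (\<lambda>i. norm (x i)) {..<n}"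
  by (simp add: cnorm_def L2_set_def norm_cquat_def inner_cquat_def sum.distrib power2_eq_square)

text \<open>The real part of a product is a Euclidean inner product after flipping the signs of the
  \<open>i\<close> and \<open>k\<close> components of one factor, an isometry of $\mathbb{R}^4$. Hence Cauchy-Schwarz
  holds for \<open>Re (a\<^sup>T x)\<close>, with constant 1.\<close>

lemma cqRe_mult_le: "cqRe (a * b) \<le> norm a * norm b"
proof -
  let ?a = "CQ (cqRe a) (- cqI a) (cqJ a) (- cqK a)"
  have "cqRe (a * b) = inner ?a b"
    by (simp add: times_cquat_def inner_cquat_def)
  also have "\<dots> \<le> norm ?a * norm b"
    by (rule norm_cauchy_schwarz)
  also have "norm ?a = norm a"
    by (simp add: norm_cquat_def inner_cquat_def)
  finally show ?thesis .
qed

lemma cqRe_linear_form_le_cnorm: "cqRe (\<Sum>i<n. a i * x i) \<le> cnorm n a * cnorm n x"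
proof -
  have "cqRe (\<Sum>i<n. a i * x i) \<le> (\<Sum>i<n. \<bar>norm (a i)\<bar> * \<bar>norm (x i)\<bar>)"
    unfolding cqRe_sum by (intro sum_mono) (simp add: cqRe_mult_le)
  also have "\<dots> \<le> cnorm n a * cnorm n x"
    unfolding cnorm_eq_L2_set by (rule L2_set_mult_ineq)
  finally show ?thesis .
qed

section \<open>The multilinear form as a function of its slots\<close>

lemma multi_indices_Nil [simp]: "multi_indices [] = {[]}"
  by (auto simp: multi_indices_def)

lemma multi_indices_Cons:
  "multi_indices (m # ms) = (\<lambda>(i, is). i # is) ` ({..<m} \<times> multi_indices ms)"
proof (intro set_eqI iffI)
  fix "is" assume "is \<in> multi_indices (m # ms)"
  then show "is \<in> (\<lambda>(i, is). i # is) ` ({..<m} \<times> multi_indices ms)"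
    by (cases "is") (force simp: multi_indices_def All_less_Suc2 image_iff)+
next
  fix "is" assume "is \<in> (\<lambda>(i, is). i # is) ` ({..<m} \<times> multi_indices ms)"
  then show "is \<in> multi_indices (m # ms)"
    by (auto simp: multi_indices_def nth_Cons split: nat.split)
qed

lemma finite_multi_indices [simp]: "finite (multi_indices ns)"
  by (induction ns) (auto simp: multi_indices_Cons)

lemma length_multi_index: "is \<in> multi_indices ns \<Longrightarrow> length is = length ns"
  by (simp add: multi_indices_def)

lemma multi_index_less: "is \<in> multi_indices ns \<Longrightarrow> k < length ns \<Longrightarrow> is ! k < ns ! k"
  by (simp add: multi_indices_def)

lemma sum_multi_indices_Cons:
  "(\<Sum>is\<in>multi_indices (m # ms). f is) = (\<Sum>i<m. \<Sum>is\<in>multi_indices ms. f (i # is))"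
  unfolding multi_indices_Cons
  by (subst sum.reindex) (auto simp: inj_on_def sum.cartesian_product case_prod_unfold)

lemma sum_multi_indices_append:
  "(\<Sum>is\<in>multi_indices (ms @ ms'). f is) =
   (\<Sum>is\<in>multi_indices ms. \<Sum>is'\<in>multi_indices ms'. f (is @ is'))"
  by (induction ms arbitrary: f) (simp_all add: sum_multi_indices_Cons)

text \<open>The arguments of the form are given here by a function instead of a list, so that one slot can
  be exchanged by a function update; values at slots beyond the order of the tensor do not matter.\<close>

definition form_at :: "nat list \<Rightarrow> ctensor \<Rightarrow> (nat \<Rightarrow> cvec) \<Rightarrow> cquat" where
  "form_at ns F w = (\<Sum>is\<in>multi_indices ns. F is * (\<Prod>k<length ns. w k (is ! k)))"

lemma multilinear_form_eq_form_at: "multilinear_form ns F xs = form_at ns F ((!) xs)"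
  by (simp add: multilinear_form_def form_at_def)

lemma form_at_cong:
  "(\<And>k i. k < length ns \<Longrightarrow> i < ns ! k \<Longrightarrow> w k i = w' k i) \<Longrightarrow> form_at ns F w = form_at ns F w'"
  unfolding form_at_def by (intro sum.cong prod.cong refl arg_cong2[where f = "(*)"]) (simp add: multi_index_less)

lemma continuous_on_form_at:
  assumes "\<And>k i. k < length ns \<Longrightarrow> i < ns ! k \<Longrightarrow> continuous_on S (\<lambda>x. w x k i)"
  shows "continuous_on S (\<lambda>x. form_at ns F (w x))"
  unfolding form_at_def using assms
  by (intro continuous_intros) (auto simp: multi_index_less)

lemma borel_measurable_form_at:
  assumes "\<And>k i. k < length ns \<Longrightarrow> i < ns ! k \<Longrightarrow> (\<lambda>x. w x k i) \<in> borel_measurable M"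
  shows "(\<lambda>x. form_at ns F (w x)) \<in> borel_measurable M"
  unfolding form_at_def using assms
  by (intro borel_measurable_sum borel_measurable_cquat_times borel_measurable_cquat_prod borel_measurable_const) (auto simp: multi_index_less)

text \<open>Collecting the multi-indices by their \<open>k\<close>-th entry exhibits the form as a linear form in
  slot \<open>k\<close>. The coefficients depend on the remaining slots only, so they are fixed when a
  random vector is put into slot \<open>k\<close>.\<close>

lemma form_at_linear_in_slot:
  assumes k: "k < length ns"
  obtains a where "a \<in> cspace (ns ! k)"
    "\<And>x. form_at ns F (w(k := x)) = (\<Sum>i<ns ! k. a i * x i)"
proof -
  define b where "b is = F is * (\<Prod>l\<in>{..<length ns} - {k}. w l (is ! l))" for "is"
  define a where "a = (\<lambda>i\<in>{..<ns ! k}. \<Sum>is\<in>{is \<in> multi_indices ns. is ! k = i}. b is)"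
  have "form_at ns F (w(k := x)) = (\<Sum>i<ns ! k. a i * x i)" for x
  proof -
    have "F is * (\<Prod>l<length ns. (w(k := x)) l (is ! l)) = b is * x (is ! k)" for "is"
    proof -
      have "(\<Prod>l<length ns. (w(k := x)) l (is ! l)) =
            x (is ! k) * (\<Prod>l\<in>{..<length ns} - {k}. (w(k := x)) l (is ! l))"
        using k by (subst prod.remove[of _ k]) auto
      also have "(\<Prod>l\<in>{..<length ns} - {k}. (w(k := x)) l (is ! l)) =
                 (\<Prod>l\<in>{..<length ns} - {k}. w l (is ! l))"
        by (intro prod.cong) auto
      finally show ?thesis by (simp add: b_def ac_simps)
    qed
    then have "form_at ns F (w(k := x)) = (\<Sum>is\<in>multi_indices ns. b is * x (is ! k))"
      by (simp add: form_at_def)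
    also have "\<dots> = (\<Sum>i<ns ! k. \<Sum>is\<in>{is \<in> multi_indices ns. is ! k = i}. b is * x (is ! k))"
      using k by (intro sum.group[symmetric]) (auto simp: multi_index_less)
    also have "\<dots> = (\<Sum>i<ns ! k. a i * x i)"
      by (intro sum.cong refl) (auto simp: a_def sum_distrib_right)
    finally show ?thesis .
  qed
  moreover have "a \<in> cspace (ns ! k)" by (auto simp: a_def cspace_def)
  ultimately show ?thesis using that by blast
qed

text \<open>The coefficient matrix on the right is the one that the algorithm hands to the solver.\<close>

lemma multilinear_form_two_free_slots:
  assumes "length xs = length ms"
  shows "multilinear_form (ms @ [p, q]) F (xs @ [x, y]) =
    bilinear_form p q
      (\<lambda>i j. \<Sum>is\<in>multi_indices ms. F (is @ [i, j]) * (\<Prod>k<length ms. (xs ! k) (is ! k))) x y"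
proof -
  have prod: "(\<Prod>k<length (ms @ [p, q]). ((xs @ [x, y]) ! k) ((is @ [i, j]) ! k)) =
      (\<Prod>k<length ms. (xs ! k) (is ! k)) * x i * y j"
    if "is \<in> multi_indices ms" for "is" i j
  proof -
    have "(\<Prod>k<length ms. ((xs @ [x, y]) ! k) ((is @ [i, j]) ! k)) =
        (\<Prod>k<length ms. (xs ! k) (is ! k))"
      using assms length_multi_index[OF that] by (intro prod.cong) (auto simp: nth_append)
    then show ?thesis
      using assms length_multi_index[OF that] by (simp add: nth_append)
  qed
  have "multilinear_form (ms @ [p, q]) F (xs @ [x, y]) =
     (\<Sum>is\<in>multi_indices ms. \<Sum>i<p. \<Sum>j<q.
        F (is @ [i, j]) * ((\<Prod>k<length ms. (xs ! k) (is ! k)) * x i * y j))"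
    unfolding multilinear_form_def sum_multi_indices_append
    by (intro sum.cong refl) (simp add: sum_multi_indices_Cons prod del: length_append)
  also have "\<dots> = (\<Sum>i<p. \<Sum>j<q. \<Sum>is\<in>multi_indices ms.
        F (is @ [i, j]) * ((\<Prod>k<length ms. (xs ! k) (is ! k)) * x i * y j))"
    by (subst sum.swap, intro sum.cong refl, subst sum.swap, rule refl)
  finally show ?thesis
    by (simp add: bilinear_form_def sum_distrib_right mult.assoc)
qed

section \<open>What the algorithm computes\<close>

lemma result_bind_timed [simp]: "result (bind_timed m f) = result (f (result m))"
  and steps_bind_timed [simp]: "steps (bind_timed m f) = steps m + steps (f (result m))"
  by (simp_all add: bind_timed_def)

lemma timed_primitives [simp]:
  "result (return x) = x" "steps (return x) = 0" "steps (charge t) = t"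
  "result (cq_read a) = a" "steps (cq_read a) = 4"
  "result (cq_add a b) = a + b" "steps (cq_add a b) = 4"
  "result (cq_mult a b) = a * b" "steps (cq_mult a b) = 28"
  by (simp_all add: return_def charge_def cq_read_def cq_add_def cq_mult_def)

lemma result_map_timed [simp]: "result (map_timed f xs) = map (\<lambda>x. result (f x)) xs"
  and steps_map_timed [simp]: "steps (map_timed f xs) = (\<Sum>x\<leftarrow>xs. steps (f x))"
  by (induction xs) simp_all

lemma result_loop_sum [simp]: "result (loop_sum m f) = (\<Sum>i<m. result (f i))"
  and steps_loop_sum [simp]: "steps (loop_sum m f) = (\<Sum>i<m. steps (f i) + 4)"
  by (induction m) simp_all

lemma result_nested_sum: "result (nested_sum ms f) = (\<Sum>is\<in>multi_indices ms. result (f is))"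
  by (induction ms arbitrary: f) (simp_all add: sum_multi_indices_Cons)

lemma result_mult_entries:
  "length is = length xs \<Longrightarrow>
   result (mult_entries a xs is) = a * (\<Prod>k<length xs. (xs ! k) (is ! k))"
proof (induction a xs "is" rule: mult_entries.induct)
  case (1 a x xs i "is")
  then show ?case
    by (simp add: lessThan_Suc_eq_insert_0 prod.reindex mult.assoc)
qed simp_all

lemma result_eval_form:
  assumes "length xs = length ns"
  shows "result (eval_form ns F xs) = multilinear_form ns F xs"
  unfolding eval_form_def result_nested_sum multilinear_form_def
proof (rule sum.cong[OF refl])
  fix "is" assume "is \<in> multi_indices ns"
  then have "length is = length xs" using assms length_multi_index by simp
  then show "result (bind_timed (cq_read (F is)) (\<lambda>a. mult_entries a xs is)) =
      F is * (\<Prod>k<length ns. (xs ! k) (is ! k))"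
    using assms by (simp add: result_mult_entries)
qed

lemma result_contract:
  assumes "length xs = length ms" "i < p" "j < q"
  shows "result (contract (ms @ [p, q]) F xs) i j =
    (\<Sum>is\<in>multi_indices ms. F (is @ [i, j]) * (\<Prod>k<length ms. (xs ! k) (is ! k)))"
proof -
  have "result (contract (ms @ [p, q]) F xs) i j = (\<Sum>is\<in>multi_indices ms.
      result (bind_timed (cq_read (F (is @ [i, j]))) (\<lambda>a. mult_entries a xs is)))"
    using assms by (simp add: contract_def tabulate_def result_nested_sum nth_append)
  also have "\<dots> =
      (\<Sum>is\<in>multi_indices ms. F (is @ [i, j]) * (\<Prod>k<length ms. (xs ! k) (is ! k)))"
  proof (rule sum.cong[OF refl])
    fix "is" assume "is \<in> multi_indices ms"
    then have "length is = length xs" using assms length_multi_index by simp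
    then show "result (bind_timed (cq_read (F (is @ [i, j]))) (\<lambda>a. mult_entries a xs is)) =
        F (is @ [i, j]) * (\<Prod>k<length ms. (xs ! k) (is ! k))"
      using assms by (simp add: result_mult_entries)
  qed
  finally show ?thesis .
qed

abbreviation drawn :: "nat list \<Rightarrow> samples \<Rightarrow> nat \<Rightarrow> cvec list" where
  "drawn ns \<omega> r \<equiv> map (\<lambda>k. \<omega> (r, k)) [0..<length ns - 2]"

lemma split_last_two:
  assumes "length ns \<ge> 2"
  shows "ns = take (length ns - 2) ns @ [ns ! (length ns - 2), ns ! (length ns - 1)]"
proof -
  have "drop (length ns - 2) ns = ns ! (length ns - 2) # drop (length ns - 1) ns"
    using assms Cons_nth_drop_Suc[of "length ns - 2" ns] by (simp add: Suc_diff_Suc numeral_2_eq_2)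
  also have "drop (length ns - 1) ns = [ns ! (length ns - 1)]"
    using assms Cons_nth_drop_Suc[of "length ns - 1" ns] by simp
  finally show ?thesis by (metis append_take_drop_id)
qed

lemma exact_poly_solver_optimal:
  assumes "exact_poly_solver solve" "p > 0" "q > 0" "result (solve p q B) = (x, y)"
  shows "x \<in> csphere p" "y \<in> csphere q"
    "\<And>u v. u \<in> csphere p \<Longrightarrow> v \<in> csphere q \<Longrightarrow>
       cqRe (bilinear_form p q B u v) \<le> cqRe (bilinear_form p q B x y)"
proof -
  have "\<forall>p>0. \<forall>q>0. \<forall>B. case result (solve p q B) of (x, y) \<Rightarrow>
      x \<in> csphere p \<and> y \<in> csphere q \<and> (\<forall>u\<in>csphere p. \<forall>v\<in>csphere q.
         cqRe (bilinear_form p q B u v) \<le> cqRe (bilinear_form p q B x y))"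
    using assms(1) unfolding exact_poly_solver_def by (rule conjunct1)
  then have *: "x \<in> csphere p \<and> y \<in> csphere q \<and> (\<forall>u\<in>csphere p. \<forall>v\<in>csphere q.
         cqRe (bilinear_form p q B u v) \<le> cqRe (bilinear_form p q B x y))"
    using assms(2-4) by (metis (no_types, lifting) old.prod.case)
  show "x \<in> csphere p" "y \<in> csphere q" using * by simp_all
  show "cqRe (bilinear_form p q B u v) \<le> cqRe (bilinear_form p q B x y)"
    if "u \<in> csphere p" "v \<in> csphere q" for u v
    using * that by simp
qed

text \<open>A trial reports a pair that is optimal for the drawn vectors together with its objective value.
  Which optimal pair the solver picks is unknown, but the value does not depend on the choice;
  the probabilistic argument uses only this description.\<close>

lemma trial_optimal_completion:
  assumes solver: "exact_poly_solver solve" and d: "length ns \<ge> 2"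
    and pos: "\<And>k. k < length ns \<Longrightarrow> ns ! k > 0"
  obtains x y where "x \<in> csphere (ns ! (length ns - 2))" "y \<in> csphere (ns ! (length ns - 1))"
    "result (trial solve ns F \<omega> r) =
       (drawn ns \<omega> r @ [x, y], cqRe (multilinear_form ns F (drawn ns \<omega> r @ [x, y])))"
    "\<And>u v. u \<in> csphere (ns ! (length ns - 2)) \<Longrightarrow> v \<in> csphere (ns ! (length ns - 1)) \<Longrightarrow>
       cqRe (multilinear_form ns F (drawn ns \<omega> r @ [u, v])) \<le>
       cqRe (multilinear_form ns F (drawn ns \<omega> r @ [x, y]))"
proof -
  define ms p q where "ms = take (length ns - 2) ns" and "p = ns ! (length ns - 2)"
    and "q = ns ! (length ns - 1)"
  define xs where "xs = drawn ns \<omega> r"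
  have ns: "ns = ms @ [p, q]" unfolding ms_def p_def q_def by (rule split_last_two[OF d])
  have len: "length xs = length ms" by (simp add: ms_def xs_def)
  define B where "B = result (contract ns F xs)"
  obtain x y where xy: "result (solve p q B) = (x, y)" by (cases "result (solve p q B)")
  have "p > 0" "q > 0" using d pos by (auto simp: p_def q_def)
  note opt = exact_poly_solver_optimal[OF solver this xy]
  have bil: "multilinear_form ns F (xs @ [u, v]) = bilinear_form p q B u v" for u v
  proof -
    have "multilinear_form ns F (xs @ [u, v]) = bilinear_form p q
      (\<lambda>i j. \<Sum>is\<in>multi_indices ms. F (is @ [i, j]) * (\<Prod>k<length ms. (xs ! k) (is ! k))) u v"
      by (subst ns) (rule multilinear_form_two_free_slots[OF len])
    also have "\<dots> = bilinear_form p q B u v"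
      unfolding bilinear_form_def B_def
      by (subst ns, intro sum.cong refl arg_cong2[where f = "(*)"] result_contract[OF len, symmetric])
        auto
    finally show ?thesis .
  qed
  have "length (xs @ [x, y]) = length ns" using len ns by simp
  then have eval: "result (eval_form ns F (xs @ [x, y])) = multilinear_form ns F (xs @ [x, y])"
    by (rule result_eval_form)
  have "result (trial solve ns F \<omega> r) = (xs @ [x, y], cqRe (result (eval_form ns F (xs @ [x, y]))))"
    using xy by (simp add: trial_def Let_def draw_def B_def p_def q_def xs_def)
  with that[of x y] opt bil eval show ?thesis by (simp add: p_def q_def xs_def)
qed

text \<open>The loop keeps a new trial only if it is strictly better, so the surviving trial is determined
  by the values of all trials alone, independently of the solutions attached to them.\<close>

primrec best_index :: "(nat \<Rightarrow> real) \<Rightarrow> nat \<Rightarrow> nat" where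
  "best_index V 0 = 0"
| "best_index V (Suc r) = (if V (Suc r) > V (best_index V r) then Suc r else best_index V r)"

lemma best_index_le: "best_index V R \<le> R"
  by (induction R) auto

lemma best_index_max: "r \<le> R \<Longrightarrow> V r \<le> V (best_index V R)"
  by (induction R) (auto simp: le_Suc_eq)

lemma result_best_trial:
  "result (best_trial solve ns F \<omega> R) =
   result (trial solve ns F \<omega> (best_index (\<lambda>r. snd (result (trial solve ns F \<omega> r))) R))"
  by (induction R) (simp_all add: case_prod_unfold)

lemma result_algorithm_A:
  "result (algorithm_A solve \<epsilon> \<gamma> c ns F \<omega>) =
   fst (result (trial solve ns F \<omega> (best_index (\<lambda>r. snd (result (trial solve ns F \<omega> r)))
     (repetitions \<epsilon> \<gamma> c ns - 1))))"
  by (simp add: algorithm_A_def case_prod_unfold result_best_trial)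

section \<open>Running time\<close>

text \<open>One addition of cost 4 is charged for each iteration of each of the nested loops; carrying it to
  the innermost level adds 4 for each level.\<close>

lemma steps_nested_sum_le:
  assumes S: "S \<ge> 1" and "\<And>m. m \<in> set ms \<Longrightarrow> m \<le> S" "\<And>is. steps (f is) \<le> t"
  shows "steps (nested_sum ms f) \<le> (t + 4 * length ms) * S ^ length ms"
  using assms(2-)
proof (induction ms arbitrary: f)
  case (Cons m ms)
  define X where "X = S ^ length ms"
  define l where "l = length ms"
  have X: "X \<ge> 1" unfolding X_def using S by (rule one_le_power)
  have "steps (nested_sum (m # ms) f) \<le> (\<Sum>i<m. (t + 4 * l) * X + 4)"
    unfolding nested_sum.simps steps_loop_sum X_def l_def
    using Cons.prems by (intro sum_mono add_right_mono Cons.IH) auto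
  also have "\<dots> = m * ((t + 4 * l) * X + 4)"
    by simp
  also have "\<dots> \<le> S * ((t + 4 * l) * X + 4 * X)"
    using Cons.prems(1)[of m] X by (intro mult_le_mono) auto
  also have "\<dots> = (t + 4 * length (m # ms)) * S ^ length (m # ms)"
    by (simp add: X_def l_def algebra_simps)
  finally show ?case .
qed simp

lemma steps_mult_entries_le: "steps (mult_entries a xs is) \<le> 32 * length xs"
  by (induction a xs "is" rule: mult_entries.induct) simp_all

text \<open>A term costs 4 steps for its tensor entry and \<open>4 + 28\<close> for reading and multiplying one factor
  in each slot; the summation adds 4 for each level.\<close>

lemma steps_eval_form_le:
  assumes "length xs = length ns" "sum_list ns \<ge> 1"
  shows "steps (eval_form ns F xs) \<le> (36 * length ns + 4) * sum_list ns ^ length ns"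
proof -
  have "steps (eval_form ns F xs) \<le>
      (4 + 32 * length xs + 4 * length ns) * sum_list ns ^ length ns"
    unfolding eval_form_def using assms(2)
    by (intro steps_nested_sum_le) (auto simp: member_le_sum_list steps_mult_entries_le)
  also have "4 + 32 * length xs + 4 * length ns = 36 * length ns + 4"
    using assms(1) by simp
  finally show ?thesis .
qed

lemma steps_contract_le:
  assumes d: "length ns \<ge> 2" and len: "length xs = length ns - 2" and pos: "sum_list ns \<ge> 1"
  shows "steps (contract ns F xs) \<le> (36 * length ns + 4) * sum_list ns ^ (length ns + 2)"
proof -
  define S where "S = sum_list ns"
  define ms where "ms = take (length ns - 2) ns"
  define c where "c = 36 * length ns + 4"
  define T where "T = c * S ^ length ns"
  have mem: "m \<le> S" if "m \<in> set ms" for m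
    using that unfolding S_def ms_def by (intro member_le_sum_list) (auto dest: in_set_takeD)
  have nested: "steps (nested_sum ms
      (\<lambda>is. bind_timed (cq_read (F (is @ [i, j]))) (\<lambda>a. mult_entries a xs is))) \<le> T" for i j
  proof -
    have "steps (nested_sum ms
        (\<lambda>is. bind_timed (cq_read (F (is @ [i, j]))) (\<lambda>a. mult_entries a xs is))) \<le>
      (4 + 32 * length xs + 4 * length ms) * S ^ length ms"
      using mem pos by (intro steps_nested_sum_le) (auto simp: steps_mult_entries_le S_def)
    also have "\<dots> \<le> T"
      unfolding T_def c_def using pos len
      by (intro mult_le_mono power_increasing) (auto simp: S_def ms_def)
    finally show ?thesis .
  qed
  have "steps (contract ns F xs) \<le> (\<Sum>i<ns ! (length ns - 2). \<Sum>j<ns ! (length ns - 1). T)"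
    unfolding contract_def Let_def tabulate_def timed.sel ms_def[symmetric]
    by (intro sum_mono nested)
  also have "\<dots> = ns ! (length ns - 2) * (ns ! (length ns - 1) * T)"
    by simp
  also have "\<dots> \<le> S * (S * T)"
    unfolding S_def using d by (intro mult_le_mono member_le_sum_list order_refl) auto
  also have "\<dots> = c * S ^ (length ns + 2)"
    by (simp add: T_def)
  finally show ?thesis by (simp add: S_def c_def)
qed

lemma steps_trial_le:
  assumes solver: "\<And>p q B. p > 0 \<Longrightarrow> q > 0 \<Longrightarrow> steps (solve p q B) \<le> C * (p + q) ^ K"
    and d: "length ns \<ge> 2" and pos: "\<And>k. k < length ns \<Longrightarrow> ns ! k > 0"
  shows "steps (trial solve ns F \<omega> r) \<le>
    (72 * length ns + 12 + C) * sum_list ns ^ (length ns + 2 + K)"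
proof -
  define S where "S = sum_list ns"
  define l where "l = length ns"
  define p q where "p = ns ! (l - 2)" and "q = ns ! (l - 1)"
  define X where "X = S ^ (l + 2 + K)"
  define c where "c = 36 * l + 4"
  have pq: "p > 0" "q > 0" using d pos by (auto simp: p_def q_def l_def)
  define xs where "xs = drawn ns \<omega> r"
  define B where "B = result (contract ns F xs)"
  obtain x y where xy: "result (solve p q B) = (x, y)"
    by (cases "result (solve p q B)")
  have ns: "ns = take (l - 2) ns @ [p, q]"
    unfolding l_def p_def q_def by (rule split_last_two[OF d])
  have sum: "S = sum_list (take (l - 2) ns) + (p + q)"
    using arg_cong[OF ns, of sum_list] by (simp add: S_def)
  have S: "S \<ge> 1" using sum pq by simp
  have pow: "S ^ k \<le> X" if "k \<le> l + 2 + K" for k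
    unfolding X_def using that S by (intro power_increasing) auto
  have len: "length xs = l - 2" by (simp add: xs_def l_def)
  have "steps (trial solve ns F \<omega> r) =
      (\<Sum>k\<leftarrow>[0..<l - 2]. 4 * ns ! k) + steps (contract ns F xs) +
      steps (solve p q B) + steps (eval_form ns F (xs @ [x, y]))"
    using xy by (simp add: trial_def Let_def draw_def B_def xs_def l_def p_def q_def)
  also have "(\<Sum>k\<leftarrow>[0..<l - 2]. 4 * ns ! k) \<le> 4 * X"
  proof -
    have "map ((!) ns) [0..<l - 2] = take (l - 2) ns"
      by (intro nth_equalityI) (auto simp: l_def)
    then have "(\<Sum>k\<leftarrow>[0..<l - 2]. 4 * ns ! k) = 4 * sum_list (take (l - 2) ns)"
      by (simp add: sum_list_const_mult)
    then show ?thesis using pow[of 1] sum by simp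
  qed
  also have "steps (contract ns F xs) \<le> c * X"
  proof -
    have "steps (contract ns F xs) \<le> c * S ^ (l + 2)"
      using steps_contract_le[OF d, of xs F] len S by (simp add: l_def S_def c_def)
    also have "\<dots> \<le> c * X" by (intro mult_le_mono2 pow) simp
    finally show ?thesis .
  qed
  also have "steps (solve p q B) \<le> C * X"
  proof -
    have "steps (solve p q B) \<le> C * (p + q) ^ K"
      using pq by (rule solver)
    also have "\<dots> \<le> C * S ^ K"
      using sum by (intro mult_le_mono2 power_mono) auto
    also have "\<dots> \<le> C * X" by (intro mult_le_mono2 pow) simp
    finally show ?thesis .
  qed
  also have "steps (eval_form ns F (xs @ [x, y])) \<le> c * X"
  proof -
    have "steps (eval_form ns F (xs @ [x, y])) \<le> c * S ^ l"
      using steps_eval_form_le[of "xs @ [x, y]" ns F] len d S by (simp add: l_def S_def c_def)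
    also have "\<dots> \<le> c * X" by (intro mult_le_mono2 pow) simp
    finally show ?thesis .
  qed
  also have "4 * X + c * X + C * X + c * X = (72 * l + 12 + C) * X"
    by (simp add: c_def algebra_simps)
  finally show ?thesis by (simp add: X_def S_def l_def)
qed

lemma steps_best_trial_le:
  assumes "\<And>r. steps (trial solve ns F \<omega> r) \<le> T"
  shows "steps (best_trial solve ns F \<omega> R) \<le> Suc R * Suc T"
proof (induction R)
  case (Suc R)
  then show ?case using assms[of "Suc R"] by (simp add: case_prod_unfold)
qed (use assms in \<open>simp add: le_SucI\<close>)

text \<open>The number of repetitions is polynomial in the dimensions because \<open>\<gamma>\<close> and the order of the
  tensor are fixed: each factor $n^{4.5\gamma}\sqrt{\ln n}$ is at most $n^{4.5\gamma+1}$. The summand 2 pays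
  for rounding up and for the lower bound 1.\<close>

lemma repetitions_le:
  assumes pos: "\<And>k. k < length ns \<Longrightarrow> ns ! k > 0" and \<gamma>: "\<gamma> > 0"
    and S1: "sum_list ns \<ge> 1"
  shows "repetitions \<epsilon> \<gamma> c ns \<le>
    (nat \<lceil>\<bar>ln (1 / \<epsilon>) / c ^ (length ns - 2)\<bar>\<rceil> + 2) *
    sum_list ns ^ ((nat \<lceil>4.5 * \<gamma>\<rceil> + 1) * (length ns - 2))"
proof -
  define S where "S = sum_list ns"
  define m where "m = length ns - 2"
  \<comment> \<open>The exponent has an integral bound for \<open>4.5 \<gamma>\<close>, and one more for the square root of the logarithm.\<close>
  define e where "e = nat \<lceil>4.5 * \<gamma>\<rceil> + 1"
  define L where "L = ln (1 / \<epsilon>) * (1 / c ^ m)"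
  define P where "P = (\<Prod>k<m. real (ns ! k) powr (4.5 * \<gamma>) * sqrt (ln (real (ns ! k))))"
  have factor: "0 \<le> real n powr (4.5 * \<gamma>) * sqrt (ln (real n)) \<and>
      real n powr (4.5 * \<gamma>) * sqrt (ln (real n)) \<le> real S ^ e"
    if n: "n > 0" "n \<le> S" for n :: nat
  proof -
    have "real n powr (4.5 * \<gamma>) \<le> real n powr (real (nat \<lceil>4.5 * \<gamma>\<rceil>))"
      using n by (intro powr_mono) linarith+
    also have "\<dots> = real n ^ nat \<lceil>4.5 * \<gamma>\<rceil>"
      using n by (simp add: powr_realpow)
    also have "\<dots> \<le> real S ^ nat \<lceil>4.5 * \<gamma>\<rceil>"
      using n by (intro power_mono) auto
    finally have 1: "real n powr (4.5 * \<gamma>) \<le> real S ^ nat \<lceil>4.5 * \<gamma>\<rceil>" .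
    have "ln (real n) \<le> real n" using ln_le_minus_one[of "real n"] n by simp
    also have "\<dots> \<le> (real n)\<^sup>2" using n by (simp add: power2_eq_square)
    finally have "sqrt (ln (real n)) \<le> real n" by (simp add: real_le_lsqrt)
    then have 2: "sqrt (ln (real n)) \<le> real S" using n by simp
    have 3: "0 \<le> sqrt (ln (real n))" using n by simp
    have "real n powr (4.5 * \<gamma>) * sqrt (ln (real n)) \<le> real S ^ nat \<lceil>4.5 * \<gamma>\<rceil> * real S"
      using 1 2 3 by (intro mult_mono) auto
    then show ?thesis using 3 by (simp add: e_def mult.commute)
  qed
  have "P \<le> (\<Prod>k<m. real S ^ e)" and P0: "0 \<le> P"
  proof -
    have "0 \<le> real (ns ! k) powr (4.5 * \<gamma>) * sqrt (ln (real (ns ! k))) \<and>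
        real (ns ! k) powr (4.5 * \<gamma>) * sqrt (ln (real (ns ! k))) \<le> real S ^ e"
      if "k < m" for k
      using that pos[of k] member_le_sum_list[of "ns ! k" ns]
      by (intro factor) (auto simp: S_def m_def)
    then show "P \<le> (\<Prod>k<m. real S ^ e)" "0 \<le> P"
      unfolding P_def by (intro prod_mono prod_nonneg; blast)+
  qed
  then have P: "P \<le> real S ^ (e * m)" by (simp add: power_mult)
  have "real (repetitions \<epsilon> \<gamma> c ns) = max 1 (real (nat \<lceil>L * P\<rceil>))"
    by (simp add: repetitions_def L_def P_def m_def of_nat_max)
  also have "\<dots> \<le> \<bar>L\<bar> * P + 2"
  proof -
    have "L * P \<le> \<bar>L\<bar> * P" "0 \<le> \<bar>L\<bar> * P" using P0 by (auto intro: mult_right_mono)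
    then show ?thesis by linarith
  qed
  also have "\<dots> \<le> \<bar>L\<bar> * real S ^ (e * m) + 2 * real S ^ (e * m)"
    using P S1 by (intro add_mono mult_left_mono) (auto simp: S_def)
  also have "\<dots> = (\<bar>L\<bar> + 2) * real S ^ (e * m)" by (simp add: algebra_simps)
  also have "\<dots> \<le> real ((nat \<lceil>\<bar>L\<bar>\<rceil> + 2) * S ^ (e * m))"
    unfolding of_nat_mult of_nat_power by (intro mult_right_mono) (auto; linarith)+
  finally have "repetitions \<epsilon> \<gamma> c ns \<le> (nat \<lceil>\<bar>L\<bar>\<rceil> + 2) * S ^ (e * m)"
    by (simp only: of_nat_le_iff)
  then show ?thesis by (simp add: S_def e_def m_def L_def)
qed

lemma steps_algorithm_A_polynomial:
  assumes solver: "exact_poly_solver solve" and \<gamma>: "\<gamma> > 0" and d: "d \<ge> 2"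
  obtains C K where
    "\<And>ns F \<omega>. length ns = d \<Longrightarrow> (\<And>k. k < d \<Longrightarrow> ns ! k > 0) \<Longrightarrow>
       steps (algorithm_A solve \<epsilon> \<gamma> c ns F \<omega>) \<le> C * sum_list ns ^ K"
proof -
  have "\<exists>C K. \<forall>p>0. \<forall>q>0. \<forall>B. steps (solve p q B) \<le> C * (p + q) ^ K"
    using solver unfolding exact_poly_solver_def by (rule conjunct2)
  then obtain C0 K0
    where CK: "\<And>p q B. p > 0 \<Longrightarrow> q > 0 \<Longrightarrow> steps (solve p q B) \<le> C0 * (p + q) ^ K0"
    by metis
  define K1 where "K1 = d + 2 + K0"
  define C1 where "C1 = 72 * d + 12 + C0"
  define K2 where "K2 = (nat \<lceil>4.5 * \<gamma>\<rceil> + 1) * (d - 2)"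
  define C2 where "C2 = nat \<lceil>\<bar>ln (1 / \<epsilon>) / c ^ (d - 2)\<bar>\<rceil> + 2"
  have "steps (algorithm_A solve \<epsilon> \<gamma> c ns F \<omega>) \<le>
      (10 * d + C2 * (C1 + 1)) * sum_list ns ^ (K1 + K2)"
    if ns: "length ns = d" "\<And>k. k < d \<Longrightarrow> ns ! k > 0" for ns F \<omega>
  proof -
    define S where "S = sum_list ns"
    define N where "N = repetitions \<epsilon> \<gamma> c ns"
    have "ns ! 0 \<le> sum_list ns" using ns d by (intro member_le_sum_list) auto
    then have S: "S \<ge> 1" using ns(2)[of 0] d by (simp add: S_def)
    have "steps (trial solve ns F \<omega> r) \<le> C1 * S ^ K1" for r
      using steps_trial_le[OF CK, where ns = ns and F = F and \<omega> = \<omega> and r = r] ns d by (simp add: C1_def K1_def S_def)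
    then have "steps (best_trial solve ns F \<omega> (N - 1)) \<le> Suc (N - 1) * Suc (C1 * S ^ K1)"
      by (rule steps_best_trial_le)
    also have "Suc (N - 1) = N"
      by (simp add: N_def repetitions_def)
    also have "N * Suc (C1 * S ^ K1) \<le> (C2 * S ^ K2) * ((C1 + 1) * S ^ K1)"
    proof (rule mult_le_mono)
      show "N \<le> C2 * S ^ K2"
        using repetitions_le[OF _ \<gamma>, of ns \<epsilon> c] ns S by (simp add: C2_def K2_def S_def N_def)
      show "Suc (C1 * S ^ K1) \<le> (C1 + 1) * S ^ K1"
        using one_le_power[OF S, of K1] by simp
    qed
    finally have "steps (algorithm_A solve \<epsilon> \<gamma> c ns F \<omega>) \<le>
        10 * d + (C2 * S ^ K2) * ((C1 + 1) * S ^ K1)"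
      using ns by (simp add: algorithm_A_def case_prod_unfold N_def)
    also have "\<dots> \<le> 10 * d * S ^ (K1 + K2) + (C2 * S ^ K2) * ((C1 + 1) * S ^ K1)"
      using one_le_power[OF S, of "K1 + K2"] by (intro add_right_mono) simp
    also have "\<dots> = (10 * d + C2 * (C1 + 1)) * S ^ (K1 + K2)"
      unfolding power_add by algebra
    finally show ?thesis by (simp add: S_def)
  qed
  then show ?thesis using that by blast
qed

section \<open>The spheres and the optimal value\<close>

lemma csphere_nonempty: "n > 0 \<Longrightarrow> csphere n \<noteq> {}"
proof -
  assume "n > 0"
  define x :: cvec where "x = (\<lambda>i\<in>{..<n}. if i = 0 then 1 else 0)"
  have "(\<Sum>i<n. (cqRe (x i))\<^sup>2) = (\<Sum>i<n. if i = 0 then 1 else 0)"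
    by (intro sum.cong) (auto simp: x_def)
  moreover have "(\<Sum>i<n. (cqI (x i))\<^sup>2) = 0" "(\<Sum>i<n. (cqJ (x i))\<^sup>2) = 0" "(\<Sum>i<n. (cqK (x i))\<^sup>2) = 0"
    by (auto simp: x_def intro!: sum.neutral)
  ultimately have "x \<in> csphere n"
    using \<open>n > 0\<close> by (auto simp: csphere_def cspace_def cnorm_def x_def)
  then show ?thesis by blast
qed

lemma norm_le_cnorm: "i < n \<Longrightarrow> norm (x i) \<le> cnorm n x"
  unfolding cnorm_eq_L2_set using member_le_L2_set[of "{..<n}" i "\<lambda>i. norm (x i)"] by simp

lemma compact_PiE_UNIV:
  fixes S :: "'i \<Rightarrow> 'a::topological_space set"
  assumes "\<And>i. compact (S i)"
  shows "compact (PiE UNIV S)"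
  using assms compactin_PiE[of "\<lambda>_. euclidean" UNIV S] by (simp add: euclidean_product_topology)

text \<open>Closed and bounded does not suffice in the space of all functions on the naturals; compactness
  comes from Tychonoff's theorem, as all entries lie in the unit ball or are constant.\<close>

lemma compact_csphere: "compact (csphere n)"
proof -
  have eq: "csphere n = PiE UNIV (\<lambda>i. if i < n then cball 0 1 else {undefined}) \<inter> {x. cnorm n x = 1}"
  proof (intro equalityI subsetI)
    fix x assume "x \<in> csphere n"
    then show "x \<in> PiE UNIV (\<lambda>i. if i < n then cball 0 1 else {undefined}) \<inter> {x. cnorm n x = 1}"
      using norm_le_cnorm[of _ n x] by (auto simp: csphere_def cspace_def PiE_def extensional_def)
  next
    fix x assume x: "x \<in> PiE UNIV (\<lambda>i. if i < n then cball 0 1 else {undefined}) \<inter> {x. cnorm n x = 1}"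
    have "x i = undefined" if "\<not> i < n" for i
      using that PiE_mem[OF IntD1[OF x], of i] by simp
    with x show "x \<in> csphere n"
      by (auto simp: csphere_def cspace_def PiE_def extensional_def)
  qed
  have "closed {x. cnorm n x = 1}"
    unfolding cnorm_def
    by (intro closed_Collect_eq continuous_intros continuous_on_product_coordinates)
  then show ?thesis
    unfolding eq by (intro compact_Int_closed compact_PiE_UNIV) auto
qed

lemma feasible_map_upt:
  "(\<And>k. k < length ns \<Longrightarrow> X k \<in> csphere (ns ! k)) \<Longrightarrow> feasible ns (map X [0..<length ns])"
  by (simp add: feasible_def)

lemma multilinear_form_map_upt:
  "multilinear_form ns F (map X [0..<length ns]) = form_at ns F X"
  unfolding multilinear_form_eq_form_at by (rule form_at_cong) simp

text \<open>The feasible points, extended by a fixed value to the slots beyond the order of the tensor, form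
  a product of compact sets, on which the objective is continuous.\<close>

lemma opt_value_attained:
  assumes pos: "\<And>k. k < length ns \<Longrightarrow> ns ! k > 0"
  obtains X where "\<And>k. k < length ns \<Longrightarrow> X k \<in> csphere (ns ! k)"
    "opt_value ns F = cqRe (form_at ns F X)"
proof -
  \<comment> \<open>The constant \<open>undefined\<close> makes the unused slots compact as well.\<close>
  define S :: "nat \<Rightarrow> cvec set"
    where "S k = (if k < length ns then csphere (ns ! k) else {undefined})" for k
  have "compact (PiE UNIV S)"
    by (intro compact_PiE_UNIV) (auto simp: S_def compact_csphere)
  moreover have "PiE UNIV S \<noteq> {}"
    using pos csphere_nonempty by (auto simp: PiE_eq_empty_iff S_def)
  moreover have "continuous_on (PiE UNIV S) (\<lambda>w. cqRe (form_at ns F w))"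
  proof (intro continuous_intros continuous_on_form_at)
    fix k i
    show "continuous_on (PiE UNIV S) (\<lambda>w. w k i)"
      by (rule continuous_on_product_then_coordinatewise)
        (rule continuous_on_subset[OF continuous_on_product_coordinates subset_UNIV])
  qed
  ultimately obtain X where X: "X \<in> PiE UNIV S"
    "\<And>w. w \<in> PiE UNIV S \<Longrightarrow> cqRe (form_at ns F w) \<le> cqRe (form_at ns F X)"
    using continuous_attains_sup[of "PiE UNIV S" "\<lambda>w. cqRe (form_at ns F w)"] by blast
  have Xk: "X k \<in> csphere (ns ! k)" if "k < length ns" for k
    using PiE_mem[OF X(1), of k] that by (simp add: S_def)
  have "opt_value ns F = cqRe (form_at ns F X)"
    unfolding opt_value_def
  proof (rule cSup_eq_maximum)
    show "cqRe (form_at ns F X) \<in> (\<lambda>xs. cqRe (multilinear_form ns F xs)) ` {xs. feasible ns xs}"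
      using feasible_map_upt[of ns X] Xk multilinear_form_map_upt[of ns F X]
      by (intro image_eqI[where x = "map X [0..<length ns]"]) auto
    fix v assume "v \<in> (\<lambda>xs. cqRe (multilinear_form ns F xs)) ` {xs. feasible ns xs}"
    then obtain xs where xs: "feasible ns xs" "v = cqRe (multilinear_form ns F xs)" by auto
    define w where "w k = (if k < length ns then xs ! k else undefined)" for k
    have "w \<in> PiE UNIV S" using xs(1) by (auto simp: feasible_def w_def S_def)
    moreover have "form_at ns F w = multilinear_form ns F xs"
      unfolding multilinear_form_eq_form_at by (rule form_at_cong) (simp add: w_def)
    ultimately show "v \<le> cqRe (form_at ns F X)" using X(2)[of w] xs(2) by simp
  qed
  with that Xk show ?thesis by blast
qed

section \<open>The uniform distribution on the sphere\<close>

lemma sets_unit_sphere_measure [measurable_cong, simp]: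
  "sets (unit_sphere_measure I) = sets (Pi\<^sub>M I (\<lambda>_. borel))"
  by (simp add: unit_sphere_measure_def)

lemma sets_uniform_csphere [measurable_cong, simp]:
  "sets (uniform_csphere n) = sets (Pi\<^sub>M {..<n} (\<lambda>_. borel))"
  by (simp add: uniform_csphere_def)

lemma measurable_unstack [measurable]:
  "unstack n \<in> Pi\<^sub>M ({..<4} \<times> {..<n}) (\<lambda>_. borel) \<rightarrow>\<^sub>M Pi\<^sub>M {..<n} (\<lambda>_. borel)"
  unfolding unstack_def by measurable

lemma prob_space_uniform_csphere:
  assumes "n > 0"
  shows "prob_space (uniform_csphere n)"
  unfolding uniform_csphere_def
  using assms by (intro prob_space.prob_space_distr prob_space_unit_sphere_measure)
    (auto simp: lessThan_empty_iff)

lemma measurable_cnorm [measurable]: "cnorm n \<in> borel_measurable (Pi\<^sub>M {..<n} (\<lambda>_. borel))"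
  unfolding cnorm_def by measurable

lemma AE_lborel_L2_set_nonzero:
  assumes "finite I" "I \<noteq> {}"
  shows "AE x in Pi\<^sub>M I (\<lambda>_. lborel). L2_set x I \<noteq> 0"
proof (rule AE_I')
  interpret product_sigma_finite "\<lambda>_. lborel :: real measure" by standard
  have "emeasure (Pi\<^sub>M I (\<lambda>_. lborel)) (PiE I (\<lambda>_. {0 :: real})) = 0"
    using assms by (subst emeasure_PiM) auto
  moreover have "PiE I (\<lambda>_. {0 :: real}) \<in> sets (Pi\<^sub>M I (\<lambda>_. lborel))"
    using assms by (intro sets_PiM_I_finite) auto
  ultimately show "PiE I (\<lambda>_. {0 :: real}) \<in> null_sets (Pi\<^sub>M I (\<lambda>_. lborel))"
    by auto
  show "{x \<in> space (Pi\<^sub>M I (\<lambda>_. lborel)). \<not> L2_set x I \<noteq> 0} \<subseteq> PiE I (\<lambda>_. {0 :: real})"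
    using assms by (auto simp: space_PiM L2_set_eq_0_iff PiE_def extensional_def fun_eq_iff)
qed

text \<open>The radial projection lands on the sphere except at the origin, where division by zero makes it
  return the origin itself; the origin is a null set.\<close>

lemma AE_unit_sphere_measure:
  assumes I: "finite I" "I \<noteq> {}"
  shows "AE u in unit_sphere_measure I. L2_set u I = 1"
proof -
  have [measurable]: "(\<lambda>x. \<lambda>i\<in>I. x i / L2_set x I) \<in>
      uniform_measure (Pi\<^sub>M I (\<lambda>_. lborel)) A \<rightarrow>\<^sub>M Pi\<^sub>M I (\<lambda>_. borel)" for A
    unfolding L2_set_def by measurable
  have "AE x in Pi\<^sub>M I (\<lambda>_. lborel). L2_set (\<lambda>i\<in>I. x i / L2_set x I) I = 1"
    using AE_lborel_L2_set_nonzero[OF I]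
  proof eventually_elim
    case (elim x)
    have "L2_set (\<lambda>i\<in>I. x i / L2_set x I) I = L2_set (\<lambda>i. x i * inverse (L2_set x I)) I"
      by (intro L2_set_cong) (auto simp: field_simps)
    also have "\<dots> = L2_set x I * inverse (L2_set x I)"
      by (intro L2_set_left_distrib[symmetric]) (simp add: L2_set_nonneg)
    finally show ?case using elim by simp
  qed
  then have "AE x in uniform_measure (Pi\<^sub>M I (\<lambda>_. lborel))
      {x \<in> space (Pi\<^sub>M I (\<lambda>_. lborel)). L2_set x I \<le> 1}. L2_set (\<lambda>i\<in>I. x i / L2_set x I) I = 1"
    by (intro AE_uniform_measureI) (auto simp: L2_set_def)
  then show ?thesis
    unfolding unit_sphere_measure_def
    by (subst AE_distr_iff) (auto simp: L2_set_def)
qed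

lemma cnorm_unstack: "cnorm n (unstack n u) = L2_set u ({..<4} \<times> {..<n})"
proof -
  have "(\<Sum>i\<in>{..<4} \<times> {..<n}. (u i)\<^sup>2) = (\<Sum>c<4. \<Sum>i<n. (u (c, i))\<^sup>2)"
    by (simp add: sum.cartesian_product)
  also have "\<dots> = (\<Sum>i<n. (u (0, i))\<^sup>2) + (\<Sum>i<n. (u (1, i))\<^sup>2) +
      (\<Sum>i<n. (u (2, i))\<^sup>2) + (\<Sum>i<n. (u (3, i))\<^sup>2)"
    by (simp add: eval_nat_numeral)
  finally show ?thesis
    by (simp add: cnorm_def L2_set_def unstack_def)
qed

lemma AE_uniform_csphere:
  assumes "n > 0"
  shows "AE x in uniform_csphere n. x \<in> csphere n"
proof -
  have "unstack n u \<in> cspace n" for u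
    by (simp add: cspace_def unstack_def)
  moreover have "AE u in unit_sphere_measure ({..<4} \<times> {..<n}). L2_set u ({..<4::nat} \<times> {..<n}) = 1"
    using assms by (intro AE_unit_sphere_measure) (auto simp: lessThan_empty_iff)
  ultimately have "AE u in unit_sphere_measure ({..<4} \<times> {..<n}). unstack n u \<in> csphere n"
    by (simp add: csphere_def cnorm_unstack)
  then show ?thesis
    unfolding uniform_csphere_def csphere_def
    by (subst AE_distr_iff) (auto simp: space_PiM cspace_def)
qed

lemma pred_csphere [measurable (raw)]:
  assumes "f \<in> M \<rightarrow>\<^sub>M Pi\<^sub>M {..<n} (\<lambda>_. borel)"
  shows "Measurable.pred M (\<lambda>\<omega>. f \<omega> \<in> csphere n)"
proof -
  have "csphere n = {x \<in> space (Pi\<^sub>M {..<n} (\<lambda>_. borel)). cnorm n x = 1}"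
    by (simp add: csphere_def cspace_def space_PiM)
  also have "\<dots> \<in> sets (Pi\<^sub>M {..<n} (\<lambda>_. borel))" by measurable
  finally show ?thesis using assms by (auto intro: pred_sets1)
qed

text \<open>The fraction of the objective value that survives when a vector of dimension \<open>n\<close> is replaced by a
  random one, and a lower bound on the probability that it does.\<close>

definition tail_threshold :: "real \<Rightarrow> nat \<Rightarrow> real" where
  "tail_threshold \<gamma> n = sqrt (\<gamma> * ln (real n) / real n)"

definition tail_bound :: "real \<Rightarrow> real \<Rightarrow> nat \<Rightarrow> real" where
  "tail_bound \<gamma> c n = c / (real n powr (4.5 * \<gamma>) * sqrt (ln (real n)))"

text \<open>In slot \<open>k\<close> the objective is \<open>Re (a\<^sup>T x)\<close>, so its value at any unit vector is at most
  \<open>\<parallel>a\<parallel>\<close>. The tail bound compares a uniform vector with \<open>\<parallel>a\<parallel>\<close>, hence also with any given unit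
  vector.\<close>

lemma replace_slot_by_uniform:
  assumes tail: "tail_constant \<gamma> c" and \<gamma>: "\<gamma> > 0" and k: "k < length ns"
    and n: "ns ! k \<ge> 2" "\<gamma> < ns ! k / ln (ns ! k)"
    and x: "x \<in> csphere (ns ! k)"
  shows "tail_bound \<gamma> c (ns ! k) \<le> measure (uniform_csphere (ns ! k))
    {\<xi> \<in> space (uniform_csphere (ns ! k)).
       tail_threshold \<gamma> (ns ! k) * cqRe (form_at ns F (w(k := x))) \<le>
       cqRe (form_at ns F (w(k := \<xi>)))}"
proof -
  define n where "n = ns ! k"
  define \<tau> where "\<tau> = tail_threshold \<gamma> n"
  obtain a where a: "a \<in> cspace n" "\<And>x. form_at ns F (w(k := x)) = (\<Sum>i<n. a i * x i)"
    using form_at_linear_in_slot[OF k] unfolding n_def by metis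
  have n2: "n \<ge> 2" "x \<in> csphere n" using n(1) x by (simp_all add: n_def)
  interpret prob_space "uniform_csphere n" using n2 by (intro prob_space_uniform_csphere) simp
  have "\<gamma> * ln n < n" using n by (simp add: n_def field_simps)
  then have "tail_bound \<gamma> c n \<le> measure (uniform_csphere n)
      {\<xi> \<in> space (uniform_csphere n). \<tau> * cnorm n a \<le> cqRe (\<Sum>i<n. a i * \<xi> i)}"
    using tail a(1) n2(1)
    unfolding tail_constant_def tail_bound_def tail_threshold_def \<tau>_def by simp
  also have "\<dots> \<le> measure (uniform_csphere n)
      {\<xi> \<in> space (uniform_csphere n).
        \<tau> * cqRe (\<Sum>i<n. a i * x i) \<le> cqRe (\<Sum>i<n. a i * \<xi> i)}"
  proof (rule finite_measure_mono)
    have "cqRe (\<Sum>i<n. a i * x i) \<le> cnorm n a"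
      using cqRe_linear_form_le_cnorm[of a x n] n2(2) by (simp add: csphere_def)
    then have "\<tau> * cqRe (\<Sum>i<n. a i * x i) \<le> \<tau> * cnorm n a"
      using n2(1) \<gamma> by (intro mult_left_mono) (auto simp: tail_threshold_def \<tau>_def)
    then show "{\<xi> \<in> space (uniform_csphere n). \<tau> * cnorm n a \<le> cqRe (\<Sum>i<n. a i * \<xi> i)}
      \<subseteq> {\<xi> \<in> space (uniform_csphere n).
          \<tau> * cqRe (\<Sum>i<n. a i * x i) \<le> cqRe (\<Sum>i<n. a i * \<xi> i)}"
      by auto
    show "{\<xi> \<in> space (uniform_csphere n).
        \<tau> * cqRe (\<Sum>i<n. a i * x i) \<le> cqRe (\<Sum>i<n. a i * \<xi> i)} \<in> sets (uniform_csphere n)"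
      by measurable
  qed
  finally show ?thesis unfolding a(2) \<tau>_def n_def .
qed

section \<open>Measurability of the success event\<close>

text \<open>By continuity in the parameter, the supremum exceeds \<open>t\<close> exactly if one of countably many
  functions does. No measurable choice of a maximiser is required.\<close>

lemma borel_measurable_attained_sup:
  fixes g :: "'b::{metric_space, second_countable_topology} \<Rightarrow> 'a \<Rightarrow> real"
  assumes meas: "\<And>s. s \<in> S \<Longrightarrow> g s \<in> borel_measurable M"
    and cont: "\<And>\<omega>. \<omega> \<in> space M \<Longrightarrow> continuous_on UNIV (\<lambda>s. g s \<omega>)"
    and le: "\<And>s \<omega>. \<omega> \<in> space M \<Longrightarrow> s \<in> S \<Longrightarrow> g s \<omega> \<le> V \<omega>"
    and attained: "\<And>\<omega>. \<omega> \<in> space M \<Longrightarrow> \<exists>s\<in>S. V \<omega> = g s \<omega>"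
  shows "V \<in> borel_measurable M"
  unfolding borel_measurable_iff_greater
proof
  fix t :: real
  obtain T where T: "countable T" "T \<subseteq> S" "S \<subseteq> closure T"
    by (rule separable)
  have "{\<omega> \<in> space M. t < V \<omega>} = (\<Union>s\<in>T. {\<omega> \<in> space M. t < g s \<omega>})"
  proof (intro equalityI subsetI)
    fix \<omega> assume "\<omega> \<in> {\<omega> \<in> space M. t < V \<omega>}"
    then have \<omega>: "\<omega> \<in> space M" "t < V \<omega>" by auto
    then obtain s where s: "s \<in> S" "V \<omega> = g s \<omega>" using attained by blast
    have "open {s. t < g s \<omega>}"
      using cont[OF \<omega>(1)] by (intro open_Collect_less continuous_on_const)
    moreover have "s \<in> {s. t < g s \<omega>} \<inter> closure T" using s \<omega> T by auto
    ultimately have "{s. t < g s \<omega>} \<inter> T \<noteq> {}"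
      using open_Int_closure_eq_empty[of "{s. t < g s \<omega>}" T] by blast
    then show "\<omega> \<in> (\<Union>s\<in>T. {\<omega> \<in> space M. t < g s \<omega>})" using \<omega> by auto
  next
    fix \<omega> assume "\<omega> \<in> (\<Union>s\<in>T. {\<omega> \<in> space M. t < g s \<omega>})"
    then show "\<omega> \<in> {\<omega> \<in> space M. t < V \<omega>}" using le T(2) by fastforce
  qed
  also have "\<dots> \<in> sets M"
  proof (rule sets.countable_UN''[OF T(1)])
    fix s assume "s \<in> T"
    then have [measurable]: "g s \<in> borel_measurable M" using meas T(2) by blast
    show "{\<omega> \<in> space M. t < g s \<omega>} \<in> sets M" by measurable
  qed
  finally show "{\<omega> \<in> space M. t < V \<omega>} \<in> sets M" .
qed

text \<open>The solver is an arbitrary function, so the solution of a trial need not depend measurably on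
  the samples. Its value does, being a maximum over the two free spheres.\<close>

lemma borel_measurable_trial_value:
  assumes solver: "exact_poly_solver solve" and d: "length ns \<ge> 2"
    and pos: "\<And>k. k < length ns \<Longrightarrow> ns ! k > 0"
    and coord: "\<And>k. k < length ns - 2 \<Longrightarrow> (\<lambda>\<omega>. \<omega> (r, k)) \<in> M \<rightarrow>\<^sub>M Pi\<^sub>M {..<ns ! k} (\<lambda>_. borel)"
  shows "(\<lambda>\<omega>. snd (result (trial solve ns F \<omega> r))) \<in> borel_measurable M"
proof -
  define m where "m = length ns - 2"
  define S where "S = csphere (ns ! (length ns - 2)) \<times> csphere (ns ! (length ns - 1))"
  \<comment> \<open>Slot \<open>m\<close> and the one after it range over the two spheres.\<close>
  define slots :: "cvec \<times> cvec \<Rightarrow> samples \<Rightarrow> nat \<Rightarrow> cvec"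
    where "slots s \<omega> k = (if k < m then \<omega> (r, k) else if k = m then fst s else snd s)" for s \<omega> k
  define g where "g s \<omega> = cqRe (form_at ns F (slots s \<omega>))" for s \<omega>
  have g_eq: "cqRe (multilinear_form ns F (drawn ns \<omega> r @ [u, v])) = g (u, v) \<omega>" for \<omega> u v
    unfolding multilinear_form_eq_form_at g_def
    by (intro arg_cong[where f = cqRe] form_at_cong) (auto simp: nth_append slots_def m_def nth_Cons')
  show ?thesis
  proof (rule borel_measurable_attained_sup)
    fix s assume "s \<in> S"
    have "(\<lambda>\<omega>. form_at ns F (slots s \<omega>)) \<in> borel_measurable M"
    proof (rule borel_measurable_form_at)
      fix k i assume k: "k < length ns" "i < ns ! k"
      show "(\<lambda>\<omega>. slots s \<omega> k i) \<in> borel_measurable M"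
      proof (cases "k < m")
        case True
        have "(\<lambda>\<omega>. \<omega> (r, k) i) \<in> borel_measurable M"
          using measurable_compose[OF coord[of k] measurable_component_singleton[of i]] True k
          by (simp add: m_def)
        then show ?thesis using True by (simp add: slots_def)
      qed (simp add: slots_def)
    qed
    then show "g s \<in> borel_measurable M" unfolding g_def by measurable
  next
    fix \<omega> assume "\<omega> \<in> space M"
    show "continuous_on UNIV (\<lambda>s. g s \<omega>)"
      unfolding g_def
    proof (intro continuous_intros continuous_on_form_at)
      fix k i
      have "continuous_on UNIV (\<lambda>s :: cvec \<times> cvec. fst s i)"
        "continuous_on UNIV (\<lambda>s :: cvec \<times> cvec. snd s i)"
        by (rule continuous_on_product_then_coordinatewise, intro continuous_intros)+
      then show "continuous_on UNIV (\<lambda>s. slots s \<omega> k i)"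
        by (cases "k < m"; cases "k = m") (simp_all add: slots_def)
    qed
  next
    fix \<omega>
    obtain x y where xy: "x \<in> csphere (ns ! (length ns - 2))" "y \<in> csphere (ns ! (length ns - 1))"
      "result (trial solve ns F \<omega> r) =
         (drawn ns \<omega> r @ [x, y], cqRe (multilinear_form ns F (drawn ns \<omega> r @ [x, y])))"
      "\<And>u v. u \<in> csphere (ns ! (length ns - 2)) \<Longrightarrow> v \<in> csphere (ns ! (length ns - 1)) \<Longrightarrow>
         cqRe (multilinear_form ns F (drawn ns \<omega> r @ [u, v])) \<le>
         cqRe (multilinear_form ns F (drawn ns \<omega> r @ [x, y]))"
      using trial_optimal_completion[OF solver d pos, where F = F and \<omega> = \<omega> and r = r] by blast
    then show "\<exists>s\<in>S. snd (result (trial solve ns F \<omega> r)) = g s \<omega>"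
      by (intro bexI[of _ "(x, y)"]) (auto simp: S_def g_eq)
    show "g s \<omega> \<le> snd (result (trial solve ns F \<omega> r))" if "s \<in> S" for s
      using xy that by (cases s) (auto simp: S_def g_eq)
  qed
qed

text \<open>The induction pushes the choice between the last trial and the best of the earlier ones into the
  property, which keeps every set in sight a Boolean combination of measurable sets.\<close>

lemma pred_best_index:
  assumes "\<And>r. r \<le> R \<Longrightarrow> (\<lambda>\<omega>. V \<omega> r) \<in> borel_measurable M"
    and "\<And>r. r \<le> R \<Longrightarrow> Measurable.pred M (Q r)"
  shows "Measurable.pred M (\<lambda>\<omega>. Q (best_index (V \<omega>) R) \<omega>)"
  using assms
proof (induction R arbitrary: Q)
  case (Suc R)
  define Q' where "Q' r \<omega> = (if V \<omega> (Suc R) > V \<omega> r then Q (Suc R) \<omega> else Q r \<omega>)" for r \<omega>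
  have "Measurable.pred M (\<lambda>\<omega>. Q' (best_index (V \<omega>) R) \<omega>)"
  proof (rule Suc.IH)
    fix r assume r: "r \<le> R"
    have [measurable]: "(\<lambda>\<omega>. V \<omega> r) \<in> borel_measurable M" "(\<lambda>\<omega>. V \<omega> (Suc R)) \<in> borel_measurable M"
      "Measurable.pred M (Q r)" "Measurable.pred M (Q (Suc R))"
      using Suc.prems r by auto
    show "Measurable.pred M (Q' r)" unfolding Q'_def by measurable
  qed (use Suc.prems in auto)
  also have "(\<lambda>\<omega>. Q' (best_index (V \<omega>) R) \<omega>) = (\<lambda>\<omega>. Q (best_index (V \<omega>) (Suc R)) \<omega>)"
    by (auto simp: Q'_def)
  finally show ?case .
qed simp

section \<open>The success probability of one trial\<close>

text \<open>Interpolates between a fixed point \<open>X\<close> and repetition \<open>r\<close> of the algorithm: the first \<open>j\<close>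
  slots are random, the other ones still those of \<open>X\<close>.\<close>

definition hybrid :: "(nat \<Rightarrow> cvec) \<Rightarrow> nat \<Rightarrow> nat \<Rightarrow> samples \<Rightarrow> nat \<Rightarrow> cvec" where
  "hybrid X r j \<omega> = (\<lambda>k. if k < j then \<omega> (r, k) else X k)"

lemma borel_measurable_hybrid:
  assumes "\<And>k. k < j \<Longrightarrow> (\<lambda>\<omega>. \<omega> (r, k)) \<in> M \<rightarrow>\<^sub>M Pi\<^sub>M {..<ns ! k} (\<lambda>_. borel)"
  shows "(\<lambda>\<omega>. form_at ns F (hybrid X r j \<omega>)) \<in> borel_measurable M"
proof (rule borel_measurable_form_at)
  fix k i assume k: "k < length ns" "i < ns ! k"
  show "(\<lambda>\<omega>. hybrid X r j \<omega> k i) \<in> borel_measurable M"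
  proof (cases "k < j")
    case True
    have "(\<lambda>\<omega>. \<omega> (r, k) i) \<in> borel_measurable M"
      using measurable_compose[OF assms[of k] measurable_component_singleton[of i]] True k by simp
    then show ?thesis using True by (simp add: hybrid_def)
  qed (simp add: hybrid_def)
qed

text \<open>Induction over the number of replaced slots. By Fubini, the vectors of the first \<open>j\<close> slots may be
  fixed while the next one is drawn; if the current hybrid has kept its share of the value at
  \<open>X\<close>, then \<open>replace_slot_by_uniform\<close>, applied with \<open>X j\<close> as the unit vector to be
  replaced, bounds the conditional probability that the next hybrid keeps its share.\<close>

lemma hybrid_probability:
  assumes tail: "tail_constant \<gamma> c" and \<gamma>: "\<gamma> > 0"
    and M: "\<And>i. prob_space (M i)" "\<And>k. k < m \<Longrightarrow> M (r, k) = uniform_csphere (ns ! k)"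
    and m: "m \<le> length ns"
    and ns: "\<And>k. k < m \<Longrightarrow> ns ! k \<ge> 2" "\<And>k. k < m \<Longrightarrow> \<gamma> < ns ! k / ln (ns ! k)"
    and X: "\<And>k. k < m \<Longrightarrow> X k \<in> csphere (ns ! k)"
    and j: "j \<le> m"
  shows "ennreal (\<Prod>k<j. tail_bound \<gamma> c (ns ! k)) \<le> emeasure (Pi\<^sub>M ({r} \<times> {..<j}) M)
    {\<xi> \<in> space (Pi\<^sub>M ({r} \<times> {..<j}) M).
       (\<Prod>k<j. tail_threshold \<gamma> (ns ! k)) * cqRe (form_at ns F X) \<le>
       cqRe (form_at ns F (hybrid X r j \<xi>))}"
  using j
proof (induction j)
  case 0
  have "hybrid X r 0 = (\<lambda>_. X)" by (simp add: hybrid_def fun_eq_iff)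
  then show ?case by (simp add: prob_space.emeasure_space_1 prob_space_PiM M(1))
next
  case (Suc j)
  interpret product_prob_space M UNIV by (rule product_prob_spaceI) (rule M(1))
  define P where "P j = Pi\<^sub>M ({r} \<times> {..<j}) M" for j
  define v where "v j = (\<Prod>k<j. tail_threshold \<gamma> (ns ! k)) * cqRe (form_at ns F X)" for j
  define E where "E j = {\<xi> \<in> space (P j). v j \<le> cqRe (form_at ns F (hybrid X r j \<xi>))}" for j
  define \<tau> where "\<tau> = tail_threshold \<gamma> (ns ! j)"
  define b where "b = tail_bound \<gamma> c (ns ! j)"
  have jm: "j < m" "j < length ns" using Suc.prems m by auto
  have coord: "(\<lambda>\<xi>. \<xi> (r, k)) \<in> P i \<rightarrow>\<^sub>M Pi\<^sub>M {..<ns ! k} (\<lambda>_. borel)" if "k < i" "i \<le> m" for i k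
  proof -
    have "(\<lambda>\<xi>. \<xi> (r, k)) \<in> P i \<rightarrow>\<^sub>M M (r, k)"
      unfolding P_def using that by (intro measurable_component_singleton) auto
    then show ?thesis
      using that M(2)[of k] measurable_cong_sets[OF refl sets_uniform_csphere, of "P i"] by simp
  qed
  have sets_E: "E i \<in> sets (P i)" if "i \<le> m" for i
  proof -
    have [measurable]: "(\<lambda>\<xi>. form_at ns F (hybrid X r i \<xi>)) \<in> borel_measurable (P i)"
      using coord that by (intro borel_measurable_hybrid) auto
    show ?thesis unfolding E_def by measurable
  qed
  have b0: "0 \<le> b"
    using tail ns(1)[OF jm(1)] by (auto simp: b_def tail_bound_def tail_constant_def)
  have \<tau>0: "0 \<le> \<tau>"
    using \<gamma> ns(1)[OF jm(1)] by (auto simp: \<tau>_def tail_threshold_def)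
  have P_Suc: "P (Suc j) = Pi\<^sub>M (insert (r, j) ({r} \<times> {..<j})) M"
    unfolding P_def by (rule arg_cong[where f = "\<lambda>I. Pi\<^sub>M I M"]) (auto simp: less_Suc_eq)
  have step: "ennreal b * indicator (E j) \<xi> \<le>
      (\<integral>\<^sup>+ y. indicator (E (Suc j)) (\<xi>((r, j) := y)) \<partial>(M (r, j)))"
    if \<xi>: "\<xi> \<in> space (P j)" for \<xi>
  proof (cases "\<xi> \<in> E j")
    case True
    define w where "w = hybrid X r j \<xi>"
    define A where "A = {y \<in> space (M (r, j)). \<tau> * cqRe (form_at ns F w) \<le> cqRe (form_at ns F (w(j := y)))}"
    \<comment> \<open>Slot \<open>j\<close> of the hybrid still holds \<open>X j\<close>, so \<open>w\<close> itself is the point that the random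
      vector is compared with.\<close>
    have w: "w(j := X j) = w" by (auto simp: w_def hybrid_def)
    have upd: "hybrid X r (Suc j) (\<xi>((r, j) := y)) = w(j := y)" for y
      by (auto simp: w_def hybrid_def fun_eq_iff less_Suc_eq)
    have "b \<le> measure (M (r, j)) A"
      using replace_slot_by_uniform[OF tail \<gamma> jm(2) ns(1)[OF jm(1)] ns(2)[OF jm(1)] X[OF jm(1)], of F w]
      unfolding A_def b_def \<tau>_def M(2)[OF jm(1)] w .
    then have "ennreal b \<le> emeasure (M (r, j)) A"
      by (simp add: M.emeasure_eq_measure ennreal_leI)
    also have "\<dots> = (\<integral>\<^sup>+ y. indicator A y \<partial>(M (r, j)))"
    proof (rule nn_integral_indicator[symmetric])
      have "(\<lambda>y. form_at ns F (w(j := y))) \<in> borel_measurable (M (r, j))"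
      proof (rule borel_measurable_form_at)
        fix k i assume "k < length ns" "i < ns ! k"
        then show "(\<lambda>y. (w(j := y)) k i) \<in> borel_measurable (M (r, j))"
          unfolding M(2)[OF jm(1)]
          by (cases "k = j") (simp_all add: measurable_component_singleton cong: measurable_cong_sets)
      qed
      note [measurable] = this
      show "A \<in> sets (M (r, j))" unfolding A_def by measurable
    qed
    also have "\<dots> \<le> (\<integral>\<^sup>+ y. indicator (E (Suc j)) (\<xi>((r, j) := y)) \<partial>(M (r, j)))"
    proof (intro nn_integral_mono)
      fix y assume y: "y \<in> space (M (r, j))"
      have "\<xi>((r, j) := y) \<in> E (Suc j)" if "y \<in> A"
      proof -
        have "v (Suc j) = \<tau> * v j" by (simp add: v_def \<tau>_def ac_simps)
        also have "\<dots> \<le> \<tau> * cqRe (form_at ns F w)"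
          using True \<tau>0 by (intro mult_left_mono) (auto simp: E_def w_def)
        also have "\<dots> \<le> cqRe (form_at ns F (w(j := y)))" using that by (simp add: A_def)
        finally have "v (Suc j) \<le> cqRe (form_at ns F (hybrid X r (Suc j) (\<xi>((r, j) := y))))"
          by (simp only: upd)
        moreover have "\<xi>((r, j) := y) \<in> space (P (Suc j))"
          unfolding P_Suc using \<xi> y by (auto simp: P_def space_PiM PiE_iff extensional_def)
        ultimately show ?thesis by (simp add: E_def)
      qed
      then show "indicator A y \<le> (indicator (E (Suc j)) (\<xi>((r, j) := y)) :: ennreal)"
        by (simp split: split_indicator)
    qed
    finally show ?thesis using True by simp
  qed simp
  have "ennreal (\<Prod>k<Suc j. tail_bound \<gamma> c (ns ! k)) = ennreal b * ennreal (\<Prod>k<j. tail_bound \<gamma> c (ns ! k))"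
    using b0 by (simp add: ennreal_mult'[symmetric] b_def mult.commute)
  also have "\<dots> \<le> ennreal b * emeasure (P j) (E j)"
    using Suc.IH jm unfolding P_def E_def v_def by (intro mult_left_mono) auto
  also have "\<dots> = (\<integral>\<^sup>+ \<xi>. ennreal b * indicator (E j) \<xi> \<partial>(P j))"
    using sets_E[of j] jm by (simp add: nn_integral_cmult_indicator)
  also have "\<dots> \<le> (\<integral>\<^sup>+ \<xi>. (\<integral>\<^sup>+ y. indicator (E (Suc j)) (\<xi>((r, j) := y)) \<partial>(M (r, j))) \<partial>(P j))"
    by (intro nn_integral_mono step)
  also have "\<dots> = (\<integral>\<^sup>+ \<xi>. indicator (E (Suc j)) \<xi> \<partial>(P (Suc j)))"
    unfolding P_Suc
    using sets_E[of "Suc j"] jm by (subst product_nn_integral_insert) (auto simp: P_def P_Suc[unfolded P_def])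
  also have "\<dots> = emeasure (P (Suc j)) (E (Suc j))"
    using sets_E[of "Suc j"] jm by simp
  finally show ?case unfolding P_def E_def v_def .
qed

section \<open>Independent repetitions\<close>

lemma (in product_prob_space) indep_vars_coordinates: "P.indep_vars M (\<lambda>i \<omega>. \<omega> i) I"
proof (cases "I = {}")
  case True
  then show ?thesis unfolding P.indep_vars_def P.indep_sets_def by simp
next
  case False
  have "distr (Pi\<^sub>M I M) (Pi\<^sub>M I M) (\<lambda>\<omega>. \<lambda>i\<in>I. \<omega> i) = distr (Pi\<^sub>M I M) (Pi\<^sub>M I M) (\<lambda>\<omega>. \<omega>)"
    by (intro distr_cong) (auto simp: space_PiM)
  also have "\<dots> = Pi\<^sub>M I M" by (rule distr_id)
  also have "\<dots> = Pi\<^sub>M I (\<lambda>i. distr (Pi\<^sub>M I M) (M i) (\<lambda>\<omega>. \<omega> i))"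
    by (intro PiM_cong refl) (simp add: PiM_component)
  finally show ?thesis
    using False by (subst P.indep_vars_iff_distr_eq_PiM') auto
qed

text \<open>Disjoint blocks of coordinates of a product measure are independent, and each block is distributed
  according to its own product measure.\<close>

lemma (in product_prob_space) prob_blocks:
  assumes L: "finite L" "L \<noteq> {}" and J: "disjoint_family_on J L"
    "\<And>r. r \<in> L \<Longrightarrow> finite (J r)" "\<And>r. r \<in> L \<Longrightarrow> J r \<subseteq> I"
    and A: "\<And>r. r \<in> L \<Longrightarrow> A r \<in> sets (Pi\<^sub>M (J r) M)"
  shows "P.prob {\<omega> \<in> space (Pi\<^sub>M I M). \<forall>r\<in>L. restrict \<omega> (J r) \<in> A r} =
    (\<Prod>r\<in>L. measure (Pi\<^sub>M (J r) M) (A r))"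
proof -
  have "P.indep_vars (\<lambda>r. Pi\<^sub>M (J r) M) (\<lambda>r \<omega>. restrict \<omega> (J r)) L"
    using P.indep_vars_restrict[OF indep_vars_coordinates J(3,1)] by simp
  then have "P.prob (\<Inter>r\<in>L. (\<lambda>\<omega>. restrict \<omega> (J r)) -` A r \<inter> space (Pi\<^sub>M I M)) =
      (\<Prod>r\<in>L. P.prob ((\<lambda>\<omega>. restrict \<omega> (J r)) -` A r \<inter> space (Pi\<^sub>M I M)))"
    using L(2,1) A by (rule P.indep_varsD_finite)
  also have "\<dots> = (\<Prod>r\<in>L. measure (Pi\<^sub>M (J r) M) (A r))"
  proof (intro prod.cong refl)
    fix r assume r: "r \<in> L"
    have "measure (distr (Pi\<^sub>M I M) (Pi\<^sub>M (J r) M) (\<lambda>\<omega>. restrict \<omega> (J r))) (A r) =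
        P.prob ((\<lambda>\<omega>. restrict \<omega> (J r)) -` A r \<inter> space (Pi\<^sub>M I M))"
      using A r J(3) by (intro measure_distr measurable_restrict_subset) auto
    then show "P.prob ((\<lambda>\<omega>. restrict \<omega> (J r)) -` A r \<inter> space (Pi\<^sub>M I M)) = measure (Pi\<^sub>M (J r) M) (A r)"
      using distr_PiM_restrict_finite[OF J(2,3)] r by simp
  qed
  also have "(\<Inter>r\<in>L. (\<lambda>\<omega>. restrict \<omega> (J r)) -` A r \<inter> space (Pi\<^sub>M I M)) =
      {\<omega> \<in> space (Pi\<^sub>M I M). \<forall>r\<in>L. restrict \<omega> (J r) \<in> A r}"
    using L(2) by auto
  finally show ?thesis .
qed

section \<open>The success probability of the algorithm\<close>

lemma approx_ratio_eq_prod_thresholds: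
  assumes "length ns \<ge> 2" "\<gamma> > 0"
  shows "approx_ratio \<gamma> ns = (\<Prod>k<length ns - 2. tail_threshold \<gamma> (ns ! k))"
proof -
  have "\<gamma> powr ((real (length ns) - 2) / 2) = (\<gamma> powr (1 / 2)) powr real (length ns - 2)"
    using assms by (simp add: powr_powr of_nat_diff)
  also have "\<dots> = (\<Prod>k<length ns - 2. sqrt \<gamma>)"
    using assms powr_realpow[of "sqrt \<gamma>" "length ns - 2"]
    by (simp only: powr_half_sqrt less_imp_le prod_constant card_lessThan real_sqrt_gt_zero)
  finally have "approx_ratio \<gamma> ns =
      (\<Prod>k<length ns - 2. sqrt \<gamma> * sqrt (ln (real (ns ! k)) / real (ns ! k)))"
    by (simp only: approx_ratio_def prod.distrib)
  then show ?thesis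
    by (simp add: tail_threshold_def real_sqrt_mult[symmetric])
qed

lemma tail_bound_pos: "c > 0 \<Longrightarrow> n \<ge> 2 \<Longrightarrow> 0 < tail_bound \<gamma> c n"
  by (auto simp: tail_bound_def)

text \<open>The number of repetitions is chosen as $\ln(1/\epsilon)/p$, where \<open>p\<close> is the lower bound on the
  success probability of one trial; rounding only increases it.\<close>

lemma exp_repetitions_le:
  assumes "c > 0" "\<epsilon> > 0" and ns: "\<And>k. k < length ns - 2 \<Longrightarrow> ns ! k \<ge> 2"
  shows "exp (- (\<Prod>k<length ns - 2. tail_bound \<gamma> c (ns ! k)) * real (repetitions \<epsilon> \<gamma> c ns)) \<le> \<epsilon>"
proof -
  define p where "p = (\<Prod>k<length ns - 2. tail_bound \<gamma> c (ns ! k))"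
  define Q where "Q = (\<Prod>k<length ns - 2. real (ns ! k) powr (4.5 * \<gamma>) * sqrt (ln (real (ns ! k))))"
  have p: "p > 0" unfolding p_def using assms by (intro prod_pos) (auto intro: tail_bound_pos)
  have pQ: "p = c ^ (length ns - 2) / Q"
    by (simp add: p_def Q_def tail_bound_def prod_dividef)
  have "Q > 0"
    unfolding Q_def using ns by (intro prod_pos) (force intro!: mult_pos_pos)
  have "ln (1 / \<epsilon>) * (1 / c ^ (length ns - 2)) * Q \<le> real (repetitions \<epsilon> \<gamma> c ns)"
    unfolding repetitions_def Q_def[symmetric] by linarith
  then have "p * (ln (1 / \<epsilon>) * (1 / c ^ (length ns - 2)) * Q) \<le> p * real (repetitions \<epsilon> \<gamma> c ns)"
    using p by (intro mult_left_mono) auto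
  also have "p * (ln (1 / \<epsilon>) * (1 / c ^ (length ns - 2)) * Q) = - ln \<epsilon>"
    using \<open>c > 0\<close> \<open>Q > 0\<close> \<open>\<epsilon> > 0\<close> by (simp add: pQ ln_div)
  finally have "exp (- p * real (repetitions \<epsilon> \<gamma> c ns)) \<le> exp (ln \<epsilon>)"
    by (subst exp_le_cancel_iff) linarith
  then show ?thesis using \<open>\<epsilon> > 0\<close> by (simp add: p_def)
qed

text \<open>The trials are independent and each fails with probability at most \<open>1 - p\<close>, so all of them fail
  with probability at most $(1-p)^N \le e^{-pN}$.\<close>

lemma some_trial_succeeds:
  fixes ns F X \<gamma> c
  defines "m \<equiv> length ns - 2"
  defines "T \<equiv> (\<Prod>k<m. tail_threshold \<gamma> (ns ! k)) * cqRe (form_at ns F X)"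
    and "p \<equiv> \<Prod>k<m. tail_bound \<gamma> c (ns ! k)"
  assumes tail: "tail_constant \<gamma> c" and \<gamma>: "\<gamma> > 0"
    and ns: "\<And>k. k < m \<Longrightarrow> ns ! k \<ge> 2" "\<And>k. k < m \<Longrightarrow> \<gamma> < ns ! k / ln (ns ! k)"
    and X: "\<And>k. k < m \<Longrightarrow> X k \<in> csphere (ns ! k)"
    and N: "N > 0"
  shows "1 - exp (- p * real N) \<le> measure (sample_space ns N)
    {\<omega> \<in> space (sample_space ns N). \<exists>r<N. T \<le> cqRe (form_at ns F (hybrid X r m \<omega>))}"
proof -
  define I where "I = {..<N} \<times> {..<m}"
  \<comment> \<open>Dimension 1 makes the family a probability measure also at the indices outside the sample
    space.\<close>
  define M where "M = (\<lambda>(r :: nat, k). uniform_csphere (if k < m then ns ! k else 1))"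
  have prob_M: "prob_space (M i)" for i
    using ns(1) by (cases i) (force simp: M_def intro!: prob_space_uniform_csphere)
  have M_in: "M (r, k) = uniform_csphere (ns ! k)" if "k < m" for r k
    using that by (simp add: M_def)
  interpret product_prob_space M I by (rule product_prob_spaceI) (rule prob_M)
  have \<Omega>: "sample_space ns N = Pi\<^sub>M I M"
    unfolding sample_space_def I_def m_def[symmetric] by (intro PiM_cong) (auto simp: M_def)
  define J where "J r = {r} \<times> {..<m}" for r :: nat
  define good where "good r \<omega> \<longleftrightarrow> T \<le> cqRe (form_at ns F (hybrid X r m \<omega>))" for r \<omega>
  define A where "A r = {\<omega> \<in> space (Pi\<^sub>M (J r) M). \<not> good r \<omega>}" for r
  have coord: "(\<lambda>\<omega>. \<omega> (r, k)) \<in> Pi\<^sub>M K M \<rightarrow>\<^sub>M Pi\<^sub>M {..<ns ! k} (\<lambda>_. borel)"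
    if "(r, k) \<in> K" "k < m" for K r k
    using measurable_component_singleton[OF that(1), of M] M_in[OF that(2), of r]
      measurable_cong_sets[OF refl sets_uniform_csphere, of "Pi\<^sub>M K M"] by simp
  have good_meas: "Measurable.pred (Pi\<^sub>M K M) (good r)" if "J r \<subseteq> K" for K r
  proof -
    have [measurable]: "(\<lambda>\<omega>. form_at ns F (hybrid X r m \<omega>)) \<in> borel_measurable (Pi\<^sub>M K M)"
      using that by (intro borel_measurable_hybrid coord) (auto simp: J_def)
    show ?thesis unfolding good_def by measurable
  qed
  \<comment> \<open>The event of trial \<open>r\<close> looks only at the coordinates of that trial.\<close>
  have good_restrict: "good r (restrict \<omega> (J r)) \<longleftrightarrow> good r \<omega>" for r \<omega>
  proof -
    have "hybrid X r m (restrict \<omega> (J r)) = hybrid X r m \<omega>"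
      by (auto simp: hybrid_def J_def fun_eq_iff)
    then show ?thesis by (simp add: good_def)
  qed
  have A: "measure (Pi\<^sub>M (J r) M) (A r) \<le> 1 - p" for r
  proof -
    interpret J: prob_space "Pi\<^sub>M (J r) M" by (rule prob_space_PiM) (rule prob_M)
    have "ennreal p \<le> emeasure (Pi\<^sub>M (J r) M) {\<omega> \<in> space (Pi\<^sub>M (J r) M). good r \<omega>}"
      unfolding p_def J_def good_def T_def
      using ns X by (intro hybrid_probability[OF tail \<gamma> prob_M M_in]) (auto simp: m_def)
    then have "p \<le> J.prob {\<omega> \<in> space (Pi\<^sub>M (J r) M). good r \<omega>}"
      by (simp add: J.emeasure_eq_measure)
    then show ?thesis
      using J.prob_neg[of "good r"] good_meas[of r "J r"] by (simp add: A_def pred_def)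
  qed
  have "P.prob {\<omega> \<in> space (Pi\<^sub>M I M). \<not> (\<exists>r<N. good r \<omega>)} =
      P.prob {\<omega> \<in> space (Pi\<^sub>M I M). \<forall>r\<in>{..<N}. restrict \<omega> (J r) \<in> A r}"
  proof (intro arg_cong[where f = P.prob] Collect_cong conj_cong refl)
    fix \<omega> assume \<omega>: "\<omega> \<in> space (Pi\<^sub>M I M)"
    have "restrict \<omega> (J r) \<in> space (Pi\<^sub>M (J r) M)" if "r < N" for r
      using \<omega> that by (auto simp: space_PiM J_def I_def)
    then show "(\<not> (\<exists>r<N. good r \<omega>)) = (\<forall>r\<in>{..<N}. restrict \<omega> (J r) \<in> A r)"
      by (auto simp: A_def good_restrict)
  qed
  also have "\<dots> = (\<Prod>r<N. measure (Pi\<^sub>M (J r) M) (A r))"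
    using N good_meas
    by (intro prob_blocks) (auto simp: J_def I_def A_def disjoint_family_on_def lessThan_empty_iff)
  also have "\<dots> \<le> (\<Prod>r<N. exp (- p))"
  proof (intro prod_mono conjI measure_nonneg)
    fix r
    show "measure (Pi\<^sub>M (J r) M) (A r) \<le> exp (- p)"
      using A[of r] exp_ge_add_one_self[of "- p"] by linarith
  qed
  also have "\<dots> = exp (- p * real N)"
    by (simp add: exp_of_nat_mult[symmetric] mult.commute)
  finally have "P.prob {\<omega> \<in> space (Pi\<^sub>M I M). \<not> (\<exists>r<N. good r \<omega>)} \<le> exp (- p * real N)" .
  moreover have "P.prob {\<omega> \<in> space (Pi\<^sub>M I M). \<not> (\<exists>r<N. good r \<omega>)} =
      1 - P.prob {\<omega> \<in> space (Pi\<^sub>M I M). \<exists>r<N. good r \<omega>}"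
  proof (rule P.prob_neg)
    have "Measurable.pred (Pi\<^sub>M I M) (\<lambda>\<omega>. \<exists>r\<in>{..<N}. good r \<omega>)"
      by (intro pred_intros_finite good_meas) (auto simp: J_def I_def)
    then show "{\<omega> \<in> space (Pi\<^sub>M I M). \<exists>r<N. good r \<omega>} \<in> P.events"
      by (simp only: pred_def Bex_def lessThan_iff)
  qed
  ultimately show ?thesis
    unfolding \<Omega> good_def[symmetric] by linarith
qed

text \<open>A trial is at least as good as its hybrid with \<open>X\<close> in the last two slots, because the solver
  optimises over these slots, and the best trial is at least as good as a successful one. The
  samples lie on the spheres only almost surely, which is why feasibility is part of the event.\<close>

lemma success_probability:
  fixes F :: ctensor
  assumes solver: "exact_poly_solver solve" and tail: "tail_constant \<gamma> c"
    and \<gamma>: "\<gamma> > 0" and \<epsilon>: "\<epsilon> > 0" and d: "length ns \<ge> 2"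
    and ns: "\<And>k. k < length ns \<Longrightarrow> ns ! k \<ge> 2"
      "\<And>k. k < length ns - 2 \<Longrightarrow> \<gamma> < ns ! k / ln (ns ! k)"
  defines "\<Omega> \<equiv> sample_space ns (repetitions \<epsilon> \<gamma> c ns)"
    and "A \<equiv> algorithm_A solve \<epsilon> \<gamma> c ns F"
  shows "1 - \<epsilon> \<le> measure \<Omega> {\<omega> \<in> space \<Omega>. feasible ns (result (A \<omega>)) \<and>
      approx_ratio \<gamma> ns * opt_value ns F \<le> cqRe (multilinear_form ns F (result (A \<omega>)))}"
proof -
  define m where "m = length ns - 2"
  define N where "N = repetitions \<epsilon> \<gamma> c ns"
  define t where "t = approx_ratio \<gamma> ns * opt_value ns F"
  define V where "V \<omega> = (\<lambda>r. snd (result (trial solve ns F \<omega> r)))" for \<omega>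
  define sol where "sol \<omega> r = fst (result (trial solve ns F \<omega> r))" for \<omega> r
  define best where "best \<omega> = best_index (V \<omega>) (N - 1)" for \<omega>
  have pos: "ns ! k > 0" if "k < length ns" for k using ns(1)[OF that] by simp
  have c: "c > 0" using tail by (simp add: tail_constant_def)
  have N: "N > 0" by (simp add: N_def repetitions_def)
  obtain X where X: "\<And>k. k < length ns \<Longrightarrow> X k \<in> csphere (ns ! k)"
    "opt_value ns F = cqRe (form_at ns F X)"
    using opt_value_attained[OF pos, where F = F] by blast
  have t: "t = (\<Prod>k<m. tail_threshold \<gamma> (ns ! k)) * cqRe (form_at ns F X)"
    by (simp add: t_def X(2) approx_ratio_eq_prod_thresholds[OF d \<gamma>] m_def)
  have result_A: "result (A \<omega>) = sol \<omega> (best \<omega>)" for \<omega>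
    by (simp add: A_def result_algorithm_A sol_def best_def V_def N_def)
  have value_eq: "cqRe (multilinear_form ns F (sol \<omega> r)) = V \<omega> r"
    and feasible_iff: "feasible ns (sol \<omega> r) \<longleftrightarrow> (\<forall>k<m. \<omega> (r, k) \<in> csphere (ns ! k))"
    and value_ge: "cqRe (form_at ns F (hybrid X r m \<omega>)) \<le> V \<omega> r" for \<omega> r
  proof -
    obtain x y where xy: "x \<in> csphere (ns ! (length ns - 2))" "y \<in> csphere (ns ! (length ns - 1))"
      "result (trial solve ns F \<omega> r) =
         (drawn ns \<omega> r @ [x, y], cqRe (multilinear_form ns F (drawn ns \<omega> r @ [x, y])))"
      "\<And>u v. u \<in> csphere (ns ! (length ns - 2)) \<Longrightarrow> v \<in> csphere (ns ! (length ns - 1)) \<Longrightarrow>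
         cqRe (multilinear_form ns F (drawn ns \<omega> r @ [u, v])) \<le>
         cqRe (multilinear_form ns F (drawn ns \<omega> r @ [x, y]))"
      using trial_optimal_completion[OF solver d pos, where F = F and \<omega> = \<omega> and r = r] by blast
    show "cqRe (multilinear_form ns F (sol \<omega> r)) = V \<omega> r"
      by (simp add: sol_def V_def xy(3))
    have len: "length ns = Suc (Suc m)" using d by (simp add: m_def)
    show "feasible ns (sol \<omega> r) \<longleftrightarrow> (\<forall>k<m. \<omega> (r, k) \<in> csphere (ns ! k))"
      using xy(1,2) by (auto simp: sol_def xy(3) feasible_def len nth_append less_Suc_eq)
    have "multilinear_form ns F (drawn ns \<omega> r @ [X m, X (Suc m)]) = form_at ns F (hybrid X r m \<omega>)"
      unfolding multilinear_form_eq_form_at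
      by (intro form_at_cong) (auto simp: hybrid_def len nth_append less_Suc_eq)
    then show "cqRe (form_at ns F (hybrid X r m \<omega>)) \<le> V \<omega> r"
      using xy(4)[of "X m" "X (Suc m)"] X(1)[of m] X(1)[of "Suc m"] xy(3) by (simp add: V_def len)
  qed
  have coord: "(\<lambda>\<omega>. \<omega> (r, k)) \<in> \<Omega> \<rightarrow>\<^sub>M Pi\<^sub>M {..<ns ! k} (\<lambda>_. borel)" if "r < N" "k < m" for r k
  proof -
    have "(\<lambda>\<omega>. \<omega> (r, k)) \<in> \<Omega> \<rightarrow>\<^sub>M (case (r, k) of (r, k) \<Rightarrow> uniform_csphere (ns ! k))"
      unfolding \<Omega>_def sample_space_def using that
      by (intro measurable_component_singleton) (auto simp: N_def m_def)
    then show ?thesis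
      using measurable_cong_sets[OF refl sets_uniform_csphere, of \<Omega>] by simp
  qed
  \<comment> \<open>In terms of the best index, success is a property of the samples and values only; the
    solutions returned by the solver have disappeared.\<close>
  define Q where "Q r \<omega> \<longleftrightarrow> (\<forall>k<m. \<omega> (r, k) \<in> csphere (ns ! k)) \<and> t \<le> V \<omega> r" for r \<omega>
  have V_meas: "(\<lambda>\<omega>. V \<omega> r) \<in> borel_measurable \<Omega>" if "r < N" for r
    unfolding V_def using coord[OF that]
    by (intro borel_measurable_trial_value[OF solver d pos]) (auto simp: m_def)
  have "Measurable.pred \<Omega> (\<lambda>\<omega>. Q (best \<omega>) \<omega>)"
    unfolding best_def
  proof (rule pred_best_index)
    fix r assume "r \<le> N - 1"
    then have r: "r < N" using N by simp
    show "(\<lambda>\<omega>. V \<omega> r) \<in> borel_measurable \<Omega>" by (rule V_meas[OF r])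
    note [measurable] = this
    have [measurable]: "Measurable.pred \<Omega> (\<lambda>\<omega>. \<forall>k\<in>{..<m}. \<omega> (r, k) \<in> csphere (ns ! k))"
      using coord[OF r] by (intro pred_intros_finite pred_csphere) auto
    have "Q r = (\<lambda>\<omega>. (\<forall>k\<in>{..<m}. \<omega> (r, k) \<in> csphere (ns ! k)) \<and> t \<le> V \<omega> r)"
      by (simp add: Q_def fun_eq_iff Ball_def)
    also have "Measurable.pred \<Omega> \<dots>" by measurable
    finally show "Measurable.pred \<Omega> (Q r)" .
  qed
  then have sets_Q: "{\<omega> \<in> space \<Omega>. Q (best \<omega>) \<omega>} \<in> sets \<Omega>" by (simp add: pred_def)
  have prob_factor: "prob_space (case i of (r, k) \<Rightarrow> uniform_csphere (ns ! k))"
    if "i \<in> {..<N} \<times> {..<m}" for i :: "nat \<times> nat"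
    using that pos by (auto intro!: prob_space_uniform_csphere simp: m_def)
  interpret \<Omega>: prob_space \<Omega>
    unfolding \<Omega>_def sample_space_def using prob_factor
    by (intro prob_space_PiM) (simp only: N_def m_def)
  have "AE \<omega> in \<Omega>. \<omega> i \<in> csphere (ns ! snd i)" if i: "i \<in> {..<N} \<times> {..<m}" for i
    unfolding \<Omega>_def sample_space_def N_def[symmetric] m_def[symmetric]
  proof (rule AE_PiM_component[OF prob_factor i])
    show "AE x in (case i of (r, k) \<Rightarrow> uniform_csphere (ns ! k)). x \<in> csphere (ns ! snd i)"
      using i pos AE_uniform_csphere by (auto simp: m_def)
  qed
  then have "AE \<omega> in \<Omega>. \<forall>i\<in>{..<N} \<times> {..<m}. \<omega> i \<in> csphere (ns ! snd i)"
    by (intro AE_finite_allI) auto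
  then have AE_Q: "AE \<omega> in \<Omega>. (\<exists>r<N. t \<le> cqRe (form_at ns F (hybrid X r m \<omega>))) \<longrightarrow> Q (best \<omega>) \<omega>"
  proof eventually_elim
    case (elim \<omega>)
    have "best \<omega> < N" using best_index_le[of "V \<omega>" "N - 1"] N unfolding best_def by linarith
    then have "\<forall>k<m. \<omega> (best \<omega>, k) \<in> csphere (ns ! k)" using elim by auto
    moreover have "V \<omega> r \<le> V \<omega> (best \<omega>)" if "r < N" for r
      using that unfolding best_def by (intro best_index_max) simp
    ultimately show ?case
      unfolding Q_def using value_ge[of _ \<omega>] by (meson order_trans)
  qed
  have dims: "ns ! k \<ge> 2" "X k \<in> csphere (ns ! k)" if "k < length ns - 2" for k
    using that ns(1)[of k] X(1)[of k] by simp_all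
  have "exp (- (\<Prod>k<m. tail_bound \<gamma> c (ns ! k)) * real N) \<le> \<epsilon>"
    unfolding m_def N_def using dims(1) by (rule exp_repetitions_le[OF c \<epsilon>])
  then have "1 - \<epsilon> \<le> 1 - exp (- (\<Prod>k<m. tail_bound \<gamma> c (ns ! k)) * real N)"
    by simp
  also have "\<dots> \<le> measure \<Omega>
      {\<omega> \<in> space \<Omega>. \<exists>r<N. t \<le> cqRe (form_at ns F (hybrid X r m \<omega>))}"
    unfolding \<Omega>_def t N_def[symmetric] unfolding m_def
    using dims(1) ns(2) dims(2) N by (rule some_trial_succeeds[OF tail \<gamma>])
  also have "\<dots> \<le> measure \<Omega> {\<omega> \<in> space \<Omega>. Q (best \<omega>) \<omega>}"
  proof (rule \<Omega>.finite_measure_mono_AE[OF _ sets_Q])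
    show "AE \<omega> in \<Omega>. \<omega> \<in> {\<omega> \<in> space \<Omega>. \<exists>r<N. t \<le> cqRe (form_at ns F (hybrid X r m \<omega>))} \<longrightarrow>
        \<omega> \<in> {\<omega> \<in> space \<Omega>. Q (best \<omega>) \<omega>}"
      using AE_Q by eventually_elim simp
  qed
  also have "{\<omega> \<in> space \<Omega>. Q (best \<omega>) \<omega>} = {\<omega> \<in> space \<Omega>. feasible ns (result (A \<omega>)) \<and>
      approx_ratio \<gamma> ns * opt_value ns F \<le> cqRe (multilinear_form ns F (result (A \<omega>)))}"
    by (simp add: Q_def result_A value_eq feasible_iff t_def)
  finally show ?thesis .
qed

theorem theorem4p1:
  fixes d :: nat and \<epsilon> \<gamma> c :: real and solve :: solver
  assumes "d \<ge> 2" and "\<epsilon> > 0" and "\<gamma> > 0"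
    and "tail_constant \<gamma> c"
    and "exact_poly_solver solve"
  shows "\<exists>C K :: nat. \<forall>ns :: nat list. \<forall>F :: ctensor.
    length ns = d \<and> sorted ns \<and> ns ! 0 \<ge> 2 \<and> \<gamma> < ns ! 0 / ln (ns ! 0) \<and>
    (\<forall>k<d - 2. \<gamma> < ns ! k / ln (ns ! k)) \<longrightarrow>
    (let \<Omega> = sample_space ns (repetitions \<epsilon> \<gamma> c ns);
         A = algorithm_A solve \<epsilon> \<gamma> c ns F in
     (\<forall>\<omega>\<in>space \<Omega>. steps (A \<omega>) \<le> C * (sum_list ns) ^ K) \<and>
     measure \<Omega> {\<omega> \<in> space \<Omega>. feasible ns (result (A \<omega>)) \<and>
       cqRe (multilinear_form ns F (result (A \<omega>))) \<ge> approx_ratio \<gamma> ns * opt_value ns F}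
     \<ge> 1 - \<epsilon>)"
proof -
  obtain C K where CK: "\<And>ns F \<omega>. length ns = d \<Longrightarrow> (\<And>k. k < d \<Longrightarrow> ns ! k > 0) \<Longrightarrow>
      steps (algorithm_A solve \<epsilon> \<gamma> c ns F \<omega>) \<le> C * sum_list ns ^ K"
    using steps_algorithm_A_polynomial[OF assms(5,3,1), where \<epsilon> = \<epsilon> and c = c] by blast
  show ?thesis
  proof (rule exI[of _ C], rule exI[of _ K], intro allI impI)
    fix ns :: "nat list" and F :: ctensor
    assume ns: "length ns = d \<and> sorted ns \<and> ns ! 0 \<ge> 2 \<and> \<gamma> < ns ! 0 / ln (ns ! 0) \<and>
      (\<forall>k<d - 2. \<gamma> < ns ! k / ln (ns ! k))"
    have ge2: "ns ! k \<ge> 2" if "k < d" for k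
      using ns that sorted_nth_mono[of ns 0 k] by fastforce
    have "steps (algorithm_A solve \<epsilon> \<gamma> c ns F \<omega>) \<le> C * sum_list ns ^ K" for \<omega>
      using ns ge2 by (intro CK) (auto intro: less_le_trans[of 0 2])
    moreover have "1 - \<epsilon> \<le> measure (sample_space ns (repetitions \<epsilon> \<gamma> c ns))
      {\<omega> \<in> space (sample_space ns (repetitions \<epsilon> \<gamma> c ns)).
        feasible ns (result (algorithm_A solve \<epsilon> \<gamma> c ns F \<omega>)) \<and>
        approx_ratio \<gamma> ns * opt_value ns F \<le>
          cqRe (multilinear_form ns F (result (algorithm_A solve \<epsilon> \<gamma> c ns F \<omega>)))}"
      using ns ge2 assms by (intro success_probability) auto
    ultimately show "let \<Omega> = sample_space ns (repetitions \<epsilon> \<gamma> c ns);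
         A = algorithm_A solve \<epsilon> \<gamma> c ns F in
     (\<forall>\<omega>\<in>space \<Omega>. steps (A \<omega>) \<le> C * (sum_list ns) ^ K) \<and>
     measure \<Omega> {\<omega> \<in> space \<Omega>. feasible ns (result (A \<omega>)) \<and>
       cqRe (multilinear_form ns F (result (A \<omega>))) \<ge> approx_ratio \<gamma> ns * opt_value ns F}
     \<ge> 1 - \<epsilon>"
      unfolding Let_def by blast
  qed
qed

end
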